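(* Let $a,b,c,\gamma>0$ be real constants and assume that the system $$\dddot{y}(t)+a\,\ddot{y}(t)+b\,\dot{y}(t)+c\,y(t)=-\gamma\,\mathrm{sign}\bigl(\ddot{y}(t)\bigr)$$ is globally asymptotically stable. Then, on the switching surface $\{\ddot y=0\}$, the system is sticking (i.e. it stays in the sliding mode $\ddot y=0$) and has a unique solution in the Filippov sense if $$\gamma>\bigl|b\,\dot y+c\,y\bigr|.$$ Precisely: let $t_0\ge 0$ and let $x_0=(x_{0,1},x_{0,2},0)^{\top}$ satisfy $|b\,x_{0,2}+c\,x_{0,1}|<\gamma$. Then a Filippov solution $x=(x_1,x_2,x_3)^\top=(y,\dot y,\ddot y)^{\top}$ with $x(t_0)=x_0$ exists for $t\ge t_0$, and for each such solution and each $t_1>t_0$ such that $|b\,x_2(t)+c\,x_1(t)|<\gamma$ for all $t\in[t_0,t_1)$, one has $x_3(t)=\ddot y(t)=0$ for all $t\in[t_0,t_1)$, and every Filippov solution starting from $x_0$ at time $t_0$ coincides with it on $[t_0,t_1)$.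
   Context: The relay is the set-valued sign function: $\mathrm{sign}(z)=1$ for $z>0$, $\mathrm{sign}(z)=-1$ for $z<0$, and $\mathrm{sign}(0)=[-1,1]$. With the state $x=(x_1,x_2,x_3)^{\top}=(y,\dot y,\ddot y)^{\top}$ the system is the differential inclusion $\dot x\in F(x)=Ax-B\,\mathrm{sign}(x_3)$, where $$A=\begin{pmatrix}0&1&0\\0&0&1\\-c&-b&-a\end{pmatrix},\qquad B=\begin{pmatrix}0\\0\\\gamma\end{pmatrix}.$$ A Filippov solution is a locally absolutely continuous function $x(\cdot)$ with $\dot x(t)\in F(x(t))$ for almost every $t$. Globally asymptotically stable means that the equilibrium set $E=\{x: 0\in F(x)\}=\{x : x_2=x_3=0,\ |c\,x_1|\le\gamma\}$ is Lyapunov stable (for every $\varepsilon>0$ there is $\delta>0$ such that $\mathrm{dist}(x(0),E)<\delta$ implies $\mathrm{dist}(x(t),E)<\varepsilon$ for all $t\ge0$, for all solutions) and that every solution satisfies $\mathrm{dist}(x(t),E)\to0$ as $t\to\infty$. The system is called sticking on a time interval if $\ddot y(t)=0$ for all $t$ in that interval. *)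

theory Defs
  imports "HOL-Analysis.Analysis"
begin

section \<open>Filippov solutions of differential inclusions\<close>

text \<open>The sets \<open>d\<close> below range over the finite families of pairwise non-overlapping
  compact subintervals of the domain.\<close>

definition absolutely_continuous_on :: "real set \<Rightarrow> (real \<Rightarrow> 'a::real_normed_vector) \<Rightarrow> bool" where
  "absolutely_continuous_on I f \<longleftrightarrow>
     (\<forall>\<epsilon>>0. \<exists>\<delta>>0. \<forall>d S. d division_of S \<and> S \<subseteq> I \<and> (\<Sum>k\<in>d. measure lborel k) < \<delta> \<longrightarrow>
        (\<Sum>k\<in>d. norm (f (Sup k) - f (Inf k))) < \<epsilon>)"

definition locally_absolutely_continuous_on :: "real set \<Rightarrow> (real \<Rightarrow> 'a::real_normed_vector) \<Rightarrow> bool" where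
  "locally_absolutely_continuous_on I f \<longleftrightarrow>
     (\<forall>u v. {u..v} \<subseteq> I \<longrightarrow> absolutely_continuous_on {u..v} f)"

definition filippov_solution ::
    "('a::real_normed_vector \<Rightarrow> 'a set) \<Rightarrow> real set \<Rightarrow> (real \<Rightarrow> 'a) \<Rightarrow> bool" where
  "filippov_solution F I x \<longleftrightarrow>
     locally_absolutely_continuous_on I x \<and>
     (AE t in lborel. t \<in> I \<longrightarrow> (\<exists>v\<in>F (x t). (x has_vector_derivative v) (at t within I)))"

section \<open>Global asymptotic stability of the equilibrium set\<close>

definition equilibria :: "('a::real_normed_vector \<Rightarrow> 'a set) \<Rightarrow> 'a set" where
  "equilibria F = {x. 0 \<in> F x}"

text \<open>\<open>infdist\<close> to the empty set is \<open>0\<close> by convention; for the relay system below the set of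
  equilibria contains the origin.\<close>

definition lyapunov_stable :: "('a::real_normed_vector \<Rightarrow> 'a set) \<Rightarrow> bool" where
  "lyapunov_stable F \<longleftrightarrow>
     (\<forall>\<epsilon>>0. \<exists>\<delta>>0. \<forall>x. filippov_solution F {0..} x \<longrightarrow> infdist (x 0) (equilibria F) < \<delta> \<longrightarrow>
        (\<forall>t\<ge>0. infdist (x t) (equilibria F) < \<epsilon>))"

definition globally_attractive :: "('a::real_normed_vector \<Rightarrow> 'a set) \<Rightarrow> bool" where
  "globally_attractive F \<longleftrightarrow>
     (\<forall>x. filippov_solution F {0..} x \<longrightarrow>
        ((\<lambda>t. infdist (x t) (equilibria F)) \<longlongrightarrow> 0) at_top)"

definition globally_asymptotically_stable :: "('a::real_normed_vector \<Rightarrow> 'a set) \<Rightarrow> bool" where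
  "globally_asymptotically_stable F \<longleftrightarrow> lyapunov_stable F \<and> globally_attractive F"

section \<open>The third-order relay system\<close>

definition sign_set :: "real \<Rightarrow> real set" where
  "sign_set z = (if z > 0 then {1} else if z < 0 then {-1} else {-1..1})"

definition relay_A :: "real \<Rightarrow> real \<Rightarrow> real \<Rightarrow> real^3^3" where
  "relay_A a b c = vector [vector [0, 1, 0], vector [0, 0, 1], vector [-c, -b, -a]]"

definition relay_B :: "real \<Rightarrow> real^3" where
  "relay_B \<gamma> = vector [0, 0, \<gamma>]"

text \<open>The state is \<open>x = (y, y', y'')\<close>, so that \<open>x $ 3\<close> is the second derivative of the output.\<close>

definition relay_system :: "real \<Rightarrow> real \<Rightarrow> real \<Rightarrow> real \<Rightarrow> real^3 \<Rightarrow> (real^3) set" where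
  "relay_system a b c \<gamma> x = {relay_A a b c *v x - s *\<^sub>R relay_B \<gamma> | s. s \<in> sign_set (x $ 3)}"

definition sticking_on :: "real set \<Rightarrow> (real \<Rightarrow> real^3) \<Rightarrow> bool" where
  "sticking_on I x \<longleftrightarrow> (\<forall>t\<in>I. x t $ 3 = 0)"

lemma relay_A_mult:
  "relay_A a b c *v x = vector [x $ 2, x $ 3, - c * x $ 1 - b * x $ 2 - a * x $ 3]"
  by (simp add: relay_A_def vec_eq_iff forall_3 matrix_vector_mult_def sum_3)

lemma equilibria_relay_system:
  assumes "\<gamma> > 0"
  shows "equilibria (relay_system a b c \<gamma>) = {x. x $ 2 = 0 \<and> x $ 3 = 0 \<and> \<bar>c * x $ 1\<bar> \<le> \<gamma>}"
proof (intro set_eqI)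
  fix x :: "real^3"
  have "0 \<in> relay_system a b c \<gamma> x \<longleftrightarrow>
      x $ 2 = 0 \<and> x $ 3 = 0 \<and> (\<exists>s. - 1 \<le> s \<and> s \<le> 1 \<and> - (c * x $ 1) = s * \<gamma>)"
    by (auto simp: relay_system_def relay_A_mult relay_B_def sign_set_def vec_eq_iff forall_3)
  also have "(\<exists>s. - 1 \<le> s \<and> s \<le> 1 \<and> - (c * x $ 1) = s * \<gamma>) \<longleftrightarrow> \<bar>c * x $ 1\<bar> \<le> \<gamma>"
  proof
    assume "\<exists>s. - 1 \<le> s \<and> s \<le> 1 \<and> - (c * x $ 1) = s * \<gamma>"
    then obtain s where s: "\<bar>s\<bar> \<le> 1" "- (c * x $ 1) = s * \<gamma>" by (auto simp: abs_le_iff)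
    have "\<bar>c * x $ 1\<bar> = \<bar>s\<bar> * \<gamma>" using s(2) assms by (metis abs_minus abs_mult abs_of_pos)
    also have "\<dots> \<le> 1 * \<gamma>" using s(1) assms by (intro mult_right_mono) auto
    finally show "\<bar>c * x $ 1\<bar> \<le> \<gamma>" by simp
  next
    assume "\<bar>c * x $ 1\<bar> \<le> \<gamma>"
    then show "\<exists>s. - 1 \<le> s \<and> s \<le> 1 \<and> - (c * x $ 1) = s * \<gamma>"
      using assms by (intro exI[of _ "- (c * x $ 1) / \<gamma>"]) (auto simp: field_simps abs_le_iff)
  qed
  finally show "x \<in> equilibria (relay_system a b c \<gamma>) \<longleftrightarrow>
      x \<in> {x. x $ 2 = 0 \<and> x $ 3 = 0 \<and> \<bar>c * x $ 1\<bar> \<le> \<gamma>}"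
    by (simp add: equilibria_def)
qed

end

theory Submission
  imports Defs
begin

text \<open>The relay enters through the monotone map \<open>sign\<close> along \<open>B = \<gamma> e\<^sub>3\<close>, so the
  right-hand side is one-sided Lipschitz for the Euclidean norm and any two Filippov solutions satisfy
  \<open>|x(t) - z(t)| \<le> exp (L (t - s)) |x(s) - z(s)|\<close>. This gives forward uniqueness, and with the
  solution \<open>0\<close> an a priori bound, so that global existence reduces to local existence. Locally a
  solution is explicit: from every point either the linear flow with constant \<open>sign = \<plusminus>1\<close> or the motion
  \<open>(x\<^sub>1 + x\<^sub>2 t, x\<^sub>2, 0)\<close> along the switching surface solves the inclusion for a short time.
  Sticking holds because \<open>(x\<^sub>3\<^sup>2)' \<le> 2 |x\<^sub>3| (|b x\<^sub>2 + c x\<^sub>1| - \<gamma>) \<le> 0\<close> almost everywhere.\<close>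

section \<open>Absolutely continuous functions\<close>

text \<open>Neither integrals nor a general existence theorem for inclusions enter. Every
  differential inequality is reduced to \<open>absolutely_continuous_on_nonincreasing\<close>,
  applied to a weighted squared distance of two solutions, to the projection of a curve on its
  chord, and to the square of the third coordinate. The explicit local solutions last for a time
  that depends on the starting point, with no uniform lower bound at hand, so they cannot simply be
  chained. The a priori bound answers this: all solutions from one point share a Lipschitz constant
  up to any finite time, hence have a limit at the supremum of the existence times, where a further
  local solution starts. The delicate starting points lie on the edge |b x2 + c x1| = \<gamma> of
  the sliding region. Under sliding, b x2 + c x1 drifts at rate c x2, and the sign of this drift
  decides between sliding and leaving.\<close>

lemma absolutely_continuous_onD:
  assumes "absolutely_continuous_on I f" "\<epsilon> > 0"
  shows "\<exists>\<delta>>0. \<forall>d S. d division_of S \<and> S \<subseteq> I \<and> (\<Sum>k\<in>d. measure lborel k) < \<delta> \<longrightarrow>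
    (\<Sum>k\<in>d. norm (f (Sup k) - f (Inf k))) < \<epsilon>"
  using assms(1)[unfolded absolutely_continuous_on_def, rule_format, OF assms(2)] .

lemma absolutely_continuous_on_subset:
  "absolutely_continuous_on J f \<Longrightarrow> I \<subseteq> J \<Longrightarrow> absolutely_continuous_on I f"
  unfolding absolutely_continuous_on_def by (meson order_trans)

lemma division_of_realE:
  fixes d :: "real set set"
  assumes "d division_of S" "k \<in> d"
  obtains l r where "k = {l..r}" "l \<le> r" "{l..r} \<subseteq> S" "Inf k = l" "Sup k = r"
    "measure lborel k = r - l"
proof -
  obtain l r where "k = cbox l r" "k \<noteq> {}" "k \<subseteq> S"
    using division_ofD(2-4)[OF assms(1,2)] by blast
  then show ?thesis using that[of l r] by auto
qed

lemma absolutely_continuous_on_cong: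
  assumes "\<And>t. t \<in> I \<Longrightarrow> f t = g t" "absolutely_continuous_on I f"
  shows "absolutely_continuous_on I g"
proof -
  have "(\<Sum>k\<in>d. norm (f (Sup k) - f (Inf k))) = (\<Sum>k\<in>d. norm (g (Sup k) - g (Inf k)))"
    if d: "d division_of S" "S \<subseteq> I" for d S
  proof (rule sum.cong[OF refl])
    fix k assume "k \<in> d"
    then obtain l r where "l \<le> r" "{l..r} \<subseteq> S" "Inf k = l" "Sup k = r"
      using division_of_realE[OF d(1) \<open>k \<in> d\<close>] by blast
    then show "norm (f (Sup k) - f (Inf k)) = norm (g (Sup k) - g (Inf k))"
      using d(2) assms(1)[of l] assms(1)[of r] by (auto simp: subset_iff)
  qed
  note sum_eq = this
  show ?thesis
    unfolding absolutely_continuous_on_def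
  proof (intro allI impI)
    fix \<epsilon> :: real assume "\<epsilon> > 0"
    then obtain \<delta> where \<delta>: "\<delta> > 0"
      "\<forall>d S. d division_of S \<and> S \<subseteq> I \<and> (\<Sum>k\<in>d. measure lborel k) < \<delta> \<longrightarrow>
        (\<Sum>k\<in>d. norm (f (Sup k) - f (Inf k))) < \<epsilon>"
      using absolutely_continuous_onD[OF assms(2)] by blast
    show "\<exists>\<delta>>0. \<forall>d S. d division_of S \<and> S \<subseteq> I \<and> (\<Sum>k\<in>d. measure lborel k) < \<delta> \<longrightarrow>
        (\<Sum>k\<in>d. norm (g (Sup k) - g (Inf k))) < \<epsilon>"
    proof (intro exI[of _ \<delta>] conjI allI impI)
      fix d S assume d: "d division_of S \<and> S \<subseteq> I \<and> (\<Sum>k\<in>d. measure lborel k) < \<delta>"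
      then have "(\<Sum>k\<in>d. norm (f (Sup k) - f (Inf k))) < \<epsilon>"
        using \<delta>(2) by blast
      then show "(\<Sum>k\<in>d. norm (g (Sup k) - g (Inf k))) < \<epsilon>"
        using sum_eq[of d S] d by simp
    qed (fact \<delta>(1))
  qed
qed

lemma lipschitz_on_imp_absolutely_continuous_on:
  assumes "C-lipschitz_on I f"
  shows "absolutely_continuous_on I f"
  unfolding absolutely_continuous_on_def
proof (intro allI impI)
  fix \<epsilon> :: real assume e: "\<epsilon> > 0"
  have C: "C \<ge> 0" using assms lipschitz_on_nonneg by blast
  show "\<exists>\<delta>>0. \<forall>d S. d division_of S \<and> S \<subseteq> I \<and> (\<Sum>k\<in>d. measure lborel k) < \<delta> \<longrightarrow>
      (\<Sum>k\<in>d. norm (f (Sup k) - f (Inf k))) < \<epsilon>"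
  proof (intro exI[of _ "\<epsilon> / (C + 1)"] conjI allI impI)
    show "\<epsilon> / (C + 1) > 0" using e C by simp
    fix d S assume d: "d division_of S \<and> S \<subseteq> I \<and> (\<Sum>k\<in>d. measure lborel k) < \<epsilon> / (C + 1)"
    have "(\<Sum>k\<in>d. norm (f (Sup k) - f (Inf k))) \<le> (\<Sum>k\<in>d. C * measure lborel k)"
    proof (rule sum_mono)
      fix k assume "k \<in> d"
      then obtain l r where lr: "l \<le> r" "{l..r} \<subseteq> S" "Inf k = l" "Sup k = r" "measure lborel k = r - l"
        using division_of_realE[OF conjunct1[OF d] \<open>k \<in> d\<close>] by blast
      have "norm (f r - f l) \<le> C * norm (r - l)"
        using lr d by (intro lipschitz_on_normD[OF assms]) (auto simp: subset_iff)
      then show "norm (f (Sup k) - f (Inf k)) \<le> C * measure lborel k" using lr by simp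
    qed
    also have "\<dots> = C * (\<Sum>k\<in>d. measure lborel k)" by (simp add: sum_distrib_left)
    also have "\<dots> \<le> C * (\<epsilon> / (C + 1))" using d C by (intro mult_left_mono) auto
    also have "\<dots> < \<epsilon>" using e C by (simp add: field_simps)
    finally show "(\<Sum>k\<in>d. norm (f (Sup k) - f (Inf k))) < \<epsilon>" .
  qed
qed

lemma absolutely_continuous_on_imp_continuous_on:
  assumes "absolutely_continuous_on {u..v} f"
  shows "continuous_on {u..v} f"
  unfolding continuous_on_iff
proof (intro ballI allI impI)
  fix t \<epsilon> :: real assume t: "t \<in> {u..v}" and e: "0 < \<epsilon>"
  obtain \<delta> where \<delta>: "\<delta> > 0"
    "\<forall>d S. d division_of S \<and> S \<subseteq> {u..v} \<and> (\<Sum>k\<in>d. measure lborel k) < \<delta> \<longrightarrow>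
      (\<Sum>k\<in>d. norm (f (Sup k) - f (Inf k))) < \<epsilon>"
    using absolutely_continuous_onD[OF assms e] by blast
  \<comment> \<open>A single interval is already a division, so the definition specialises to
    uniform continuity.\<close>
  have *: "dist (f r) (f l) < \<epsilon>" if "l \<le> r" "{l..r} \<subseteq> {u..v}" "r - l < \<delta>" for l r
    using \<delta>(2)[rule_format, of "{{l..r}}" "{l..r}"] that division_of_self[of l r] by (simp add: dist_norm)
  show "\<exists>\<delta>>0. \<forall>s\<in>{u..v}. dist s t < \<delta> \<longrightarrow> dist (f s) (f t) < \<epsilon>"
  proof (intro exI[of _ \<delta>] conjI ballI impI)
    fix s assume s: "s \<in> {u..v}" "dist s t < \<delta>"
    show "dist (f s) (f t) < \<epsilon>"
    proof (cases "s \<le> t")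
      case True
      then show ?thesis using *[of s t] s t by (simp add: dist_real_def dist_commute)
    next
      case False
      then show ?thesis using *[of t s] s t by (simp add: dist_real_def)
    qed
  qed (fact \<delta>(1))
qed

lemma absolutely_continuous_on_bounded:
  assumes "absolutely_continuous_on {u..v} f"
  obtains B where "B > 0" "\<And>t. t \<in> {u..v} \<Longrightarrow> norm (f t) \<le> B"
proof -
  have "bounded (f ` {u..v})"
    using absolutely_continuous_on_imp_continuous_on[OF assms]
    by (intro compact_imp_bounded compact_continuous_image) auto
  then obtain B where "B > 0" "\<forall>y\<in>f ` {u..v}. norm y \<le> B"
    unfolding bounded_pos by blast
  then show ?thesis using that[of B] by blast
qed

text \<open>Common core of two closure properties: differences take \<open>M = 1\<close>, bilinear
  products take \<open>M\<close> from bounds on the two factors.\<close>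

lemma absolutely_continuous_on_dominated:
  assumes f: "absolutely_continuous_on I f" and g: "absolutely_continuous_on I g"
    and M: "\<And>s t. s \<in> I \<Longrightarrow> t \<in> I \<Longrightarrow> norm (h t - h s) \<le> M * (norm (f t - f s) + norm (g t - g s))"
  shows "absolutely_continuous_on I h"
  unfolding absolutely_continuous_on_def
proof (intro allI impI)
  fix \<epsilon> :: real assume e: "\<epsilon> > 0"
  \<comment> \<open>\<open>M\<close> may be zero or negative; a positive constant is needed to
    divide \<epsilon> by and to keep the final inequality strict.\<close>
  define K where "K = \<bar>M\<bar> + 1"
  have K: "K > 0" "M \<le> K" by (simp_all add: K_def)
  define \<eta> where "\<eta> = \<epsilon> / (2 * K)"
  have \<eta>: "\<eta> > 0" using e K by (simp add: \<eta>_def)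
  obtain \<delta>f where \<delta>f: "\<delta>f > 0"
    "\<forall>d S. d division_of S \<and> S \<subseteq> I \<and> (\<Sum>k\<in>d. measure lborel k) < \<delta>f \<longrightarrow>
      (\<Sum>k\<in>d. norm (f (Sup k) - f (Inf k))) < \<eta>"
    using absolutely_continuous_onD[OF f \<eta>] by blast
  obtain \<delta>g where \<delta>g: "\<delta>g > 0"
    "\<forall>d S. d division_of S \<and> S \<subseteq> I \<and> (\<Sum>k\<in>d. measure lborel k) < \<delta>g \<longrightarrow>
      (\<Sum>k\<in>d. norm (g (Sup k) - g (Inf k))) < \<eta>"
    using absolutely_continuous_onD[OF g \<eta>] by blast
  show "\<exists>\<delta>>0. \<forall>d S. d division_of S \<and> S \<subseteq> I \<and> (\<Sum>k\<in>d. measure lborel k) < \<delta> \<longrightarrow>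
      (\<Sum>k\<in>d. norm (h (Sup k) - h (Inf k))) < \<epsilon>"
  proof (intro exI[of _ "min \<delta>f \<delta>g"] conjI allI impI)
    fix d S assume d: "d division_of S \<and> S \<subseteq> I \<and> (\<Sum>k\<in>d. measure lborel k) < min \<delta>f \<delta>g"
    have "(\<Sum>k\<in>d. norm (h (Sup k) - h (Inf k)))
        \<le> (\<Sum>k\<in>d. K * (norm (f (Sup k) - f (Inf k)) + norm (g (Sup k) - g (Inf k))))"
    proof (rule sum_mono)
      fix k assume "k \<in> d"
      then obtain l r where lr: "l \<le> r" "{l..r} \<subseteq> S" "Inf k = l" "Sup k = r"
        using division_of_realE[OF conjunct1[OF d] \<open>k \<in> d\<close>] by blast
      then have "norm (h r - h l) \<le> M * (norm (f r - f l) + norm (g r - g l))"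
        using d by (intro M) (auto simp: subset_iff)
      also have "\<dots> \<le> K * (norm (f r - f l) + norm (g r - g l))"
        using K by (intro mult_right_mono) auto
      finally show "norm (h (Sup k) - h (Inf k))
          \<le> K * (norm (f (Sup k) - f (Inf k)) + norm (g (Sup k) - g (Inf k)))"
        using lr by simp
    qed
    also have "\<dots> = K * ((\<Sum>k\<in>d. norm (f (Sup k) - f (Inf k))) + (\<Sum>k\<in>d. norm (g (Sup k) - g (Inf k))))"
      by (simp only: sum_distrib_left[symmetric] sum.distrib)
    also have "\<dots> < K * (\<eta> + \<eta>)"
      using d \<delta>f(2)[rule_format, of d S] \<delta>g(2)[rule_format, of d S] K by (intro mult_strict_left_mono add_strict_mono) simp_all
    also have "\<dots> = \<epsilon>" using K by (simp add: \<eta>_def field_simps)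
    finally show "(\<Sum>k\<in>d. norm (h (Sup k) - h (Inf k))) < \<epsilon>" .
  qed (use \<delta>f(1) \<delta>g(1) in simp)
qed

lemma absolutely_continuous_on_diff:
  assumes "absolutely_continuous_on I f" "absolutely_continuous_on I g"
  shows "absolutely_continuous_on I (\<lambda>t. f t - g t)"
proof (rule absolutely_continuous_on_dominated[OF assms, where M = 1])
  fix s t
  have "f t - g t - (f s - g s) = (f t - f s) - (g t - g s)" by simp
  then show "norm (f t - g t - (f s - g s)) \<le> 1 * (norm (f t - f s) + norm (g t - g s))"
    by (metis norm_triangle_ineq4 mult_1)
qed

text \<open>On a compact interval both factors are bounded. The increment of the product splits into
  two terms, one with \<open>g\<close> frozen at \<open>t\<close>, the other with \<open>f\<close>
  frozen at \<open>s\<close>, and \<open>B + C\<close> bounds either frozen factor.\<close>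

lemma (in bounded_bilinear) absolutely_continuous_on:
  assumes f: "absolutely_continuous_on {u..v} f" and g: "absolutely_continuous_on {u..v} g"
  shows "absolutely_continuous_on {u..v} (\<lambda>t. prod (f t) (g t))"
proof -
  obtain B where B: "B > 0" "\<And>t. t \<in> {u..v} \<Longrightarrow> norm (f t) \<le> B"
    using absolutely_continuous_on_bounded[OF f] by blast
  obtain C where C: "C > 0" "\<And>t. t \<in> {u..v} \<Longrightarrow> norm (g t) \<le> C"
    using absolutely_continuous_on_bounded[OF g] by blast
  obtain K where K: "K > 0" "\<And>a b. norm (prod a b) \<le> norm a * norm b * K"
    using pos_bounded by blast
  show ?thesis
  proof (rule absolutely_continuous_on_dominated[OF f g, where M = "(B + C) * K"])
    fix s t assume st: "s \<in> {u..v}" "t \<in> {u..v}"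
    have "prod (f t) (g t) - prod (f s) (g s) = prod (f t - f s) (g t) + prod (f s) (g t - g s)"
      by (simp add: diff_left diff_right)
    also have "norm \<dots> \<le> norm (f t - f s) * norm (g t) * K + norm (f s) * norm (g t - g s) * K"
      by (intro norm_triangle_le add_mono K)
    also have "\<dots> \<le> norm (f t - f s) * (B + C) * K + (B + C) * norm (g t - g s) * K"
      using B(1) C(1) B(2)[OF st(1)] C(2)[OF st(2)] K(1)
      by (intro add_mono mult_mono mult_nonneg_nonneg) auto
    finally show "norm (prod (f t) (g t) - prod (f s) (g s)) \<le> (B + C) * K * (norm (f t - f s) + norm (g t - g s))"
      by (simp add: algebra_simps)
  qed
qed

lemmas absolutely_continuous_on_inner = bounded_bilinear.absolutely_continuous_on[OF bounded_bilinear_inner]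
lemmas absolutely_continuous_on_mult = bounded_bilinear.absolutely_continuous_on[OF bounded_bilinear_mult]

section \<open>Monotonicity and Lipschitz bounds from an almost everywhere derivative\<close>

lemma division_measure_le:
  fixes d :: "real set set"
  assumes "d division_of S" "S \<subseteq> U" "U \<in> sets lborel" "emeasure lborel U < ennreal \<delta>"
  shows "(\<Sum>k\<in>d. measure lborel k) < \<delta>"
proof -
  have fin: "finite d" using assms(1) by blast
  have box: "\<exists>l r. k = cbox l r" if "k \<in> d" for k using division_ofD(4)[OF assms(1) that] .
  have "S = \<Union>d" using assms(1) by blast
  moreover have "k \<in> sets lborel" if "k \<in> d" for k
    using box[OF that] by auto
  ultimately have S: "S \<in> sets lborel"
    using fin by (metis sets.finite_Union subsetI)
  have U: "U \<in> fmeasurable lborel"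
    using assms(3,4) by (intro fmeasurableI) (auto elim: order_less_trans)
  \<comment> \<open>The pieces overlap at most in endpoints, so their lengths add up to the measure
    of the union. The passage to \<open>lebesgue\<close> matches the form of
    \<open>content_division\<close>.\<close>
  have "(\<Sum>k\<in>d. measure lborel k) = (\<Sum>k\<in>d. measure lebesgue k)"
  proof (rule sum.cong[OF refl])
    fix k assume "k \<in> d"
    then obtain l r where "k = cbox l r" using box by blast
    then show "measure lborel k = measure lebesgue k" by (simp add: measure_completion)
  qed
  also have "\<dots> = measure lebesgue S" by (rule content_division[OF assms(1)])
  also have "\<dots> = measure lborel S" using S by (rule measure_completion)
  also have "\<dots> \<le> measure lborel U"
    using assms(1,2) U S by (intro measure_mono_fmeasurable) auto
  also have "\<dots> < \<delta>"
    using assms(4) by (simp add: emeasure_eq_measure2[OF U] ennreal_less_iff)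
  finally show ?thesis .
qed


text \<open>By Cousin's lemma there is a tagged division fine for a gauge that confines the exceptional
  tags to an open set of small measure, where absolute continuity controls the increments; the
  derivative controls the others.\<close>

lemma absolutely_continuous_on_nonincreasing:
  fixes f :: "real \<Rightarrow> real"
  assumes uv: "u \<le> v" and ac: "absolutely_continuous_on {u..v} f"
    and der: "AE t in lborel. t \<in> {u<..<v} \<longrightarrow> (\<exists>D\<le>0. (f has_real_derivative D) (at t))"
  shows "f v \<le> f u"
proof (rule field_le_epsilon)
  fix e :: real assume e: "e > 0"
  \<comment> \<open>The intervals with good tags will contribute at most \<eta> (v - u), the
    exceptional ones at most \<eta>; together this is \<open>e\<close>.\<close>
  define \<eta> where "\<eta> = e / (v - u + 1)"
  have "\<eta> * (v - u + 1) = e" using uv by (simp add: \<eta>_def)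
  then have \<eta>: "\<eta> > 0" "\<eta> * (v - u) + \<eta> = e"
    using e uv by (simp_all add: \<eta>_def distrib_left)
  obtain N0 where N0: "{t \<in> space lborel. \<not> (t \<in> {u<..<v} \<longrightarrow> (\<exists>D\<le>0. (f has_real_derivative D) (at t)))} \<subseteq> N0"
      "emeasure lborel N0 = 0" "N0 \<in> sets lborel"
    using der by (rule AE_E)
  \<comment> \<open>The derivative is given only inside the interval, so the endpoints are treated
    as exceptional tags.\<close>
  define N where "N = N0 \<union> {u, v}"
  have "N0 \<in> null_sets lborel" using N0 by blast
  then have N: "N \<in> null_sets lborel"
    unfolding N_def by (rule null_sets.Un) (simp add: finite_imp_null_set_lborel)
  have good: "\<exists>D\<le>0. (f has_real_derivative D) (at t)" if "t \<in> {u..v}" "t \<notin> N" for t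
    using N0(1) that by (force simp: N_def)
  obtain \<delta> where \<delta>: "\<delta> > 0"
    "\<forall>d S. d division_of S \<and> S \<subseteq> {u..v} \<and> (\<Sum>k\<in>d. measure lborel k) < \<delta> \<longrightarrow>
      (\<Sum>k\<in>d. norm (f (Sup k) - f (Inf k))) < \<eta>"
    using absolutely_continuous_onD[OF ac \<eta>(1)] by blast
  have Nb: "N \<in> sets borel" using N by auto
  obtain U where U: "open U" "N \<subseteq> U" "emeasure lborel (U - N) < ennreal \<delta>"
    using outer_regular_lborel[OF Nb \<delta>(1)] by blast
  have "emeasure lborel U = emeasure lborel (U - N)"
    using emeasure_Diff_null_set[OF N, of U] U(1) by simp
  with U have Um: "emeasure lborel U < ennreal \<delta>" by simp
  have "\<exists>r>0. (t \<in> N \<longrightarrow> ball t r \<subseteq> U) \<and>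
      (t \<in> {u..v} - N \<longrightarrow> (\<forall>l s. l \<le> t \<and> t \<le> s \<and> {l..s} \<subseteq> ball t r \<longrightarrow> f s - f l \<le> \<eta> * (s - l)))" for t
  proof (cases "t \<in> N")
    case True
    then show ?thesis using U(1,2) openE[of U t] by (metis DiffD2 subset_iff)
  next
    case False
    show ?thesis
    proof (cases "t \<in> {u..v}")
      case True
      then obtain D where D: "D \<le> 0" "(f has_real_derivative D) (at t)" using good False by blast
      then obtain r where r: "r > 0" "\<And>y. norm (y - t) < r \<Longrightarrow> norm (f y - f t - D * (y - t)) \<le> \<eta> * norm (y - t)"
        using \<eta>(1) unfolding has_field_derivative_def has_derivative_at_alt by blast
      have "f s - f l \<le> \<eta> * (s - l)" if "l \<le> t" "t \<le> s" "{l..s} \<subseteq> ball t r" for l s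
      proof -
        have "l \<in> {l..s}" "s \<in> {l..s}" using that by auto
        then have "l \<in> ball t r" "s \<in> ball t r" using that(3) by blast+
        then have "\<bar>f l - f t - D * (l - t)\<bar> \<le> \<eta> * \<bar>l - t\<bar>" "\<bar>f s - f t - D * (s - t)\<bar> \<le> \<eta> * \<bar>s - t\<bar>"
          using r(2)[of l] r(2)[of s] by (auto simp: dist_real_def abs_minus_commute)
        \<comment> \<open>The tag lies between \<open>l\<close> and \<open>s\<close>, so the two
          error terms add up to exactly \<eta> (s - l).\<close>
        then have "f s - f l \<le> D * (s - l) + \<eta> * (s - l)" using that by (simp add: algebra_simps abs_le_iff)
        also have "\<dots> \<le> \<eta> * (s - l)" using D that by (simp add: mult_nonpos_nonneg)
        finally show ?thesis .
      qed
      then show ?thesis using r(1) False by blast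
    next
      case False
      with \<open>t \<notin> N\<close> show ?thesis by (intro exI[of _ 1]) auto
    qed
  qed
  then obtain r where r: "\<And>t. r t > 0" "\<And>t. t \<in> N \<Longrightarrow> ball t (r t) \<subseteq> U"
      "\<And>t l s. t \<in> {u..v} \<Longrightarrow> t \<notin> N \<Longrightarrow> l \<le> t \<Longrightarrow> t \<le> s \<Longrightarrow> {l..s} \<subseteq> ball t (r t) \<Longrightarrow>
        f s - f l \<le> \<eta> * (s - l)"
    by (metis DiffI)
  have "gauge (\<lambda>t. ball t (r t))" using r(1) by (intro gauge_ball_dependent) auto
  then obtain p where p: "p tagged_division_of {u..v}" "(\<lambda>t. ball t (r t)) fine p"
    by (rule fine_division_exists_real)
  have fin: "finite p" using p(1) by blast
  define q where "q = {xk \<in> p. fst xk \<in> N}"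
  have qp: "q \<subseteq> p" by (auto simp: q_def)
  have interval: "\<exists>l s. K = {l..s} \<and> l \<le> x \<and> x \<le> s \<and> {l..s} \<subseteq> {u..v} \<and> {l..s} \<subseteq> ball x (r x)"
    if xK: "(x, K) \<in> p" for x K
  proof -
    obtain l s where "K = cbox l s" using tagged_division_ofD(4)[OF p(1) xK] by blast
    then show ?thesis
      using tagged_division_ofD(2,3)[OF p(1) xK] fineD[OF p(2) xK] by auto
  qed
  have "f v - f u = (\<Sum>(x,K)\<in>p. f (Sup K) - f (Inf K))"
    using additive_tagged_division_1[OF uv p(1), of f] by simp
  also have "\<dots> = (\<Sum>(x,K)\<in>q. f (Sup K) - f (Inf K)) + (\<Sum>(x,K)\<in>p - q. f (Sup K) - f (Inf K))"
    by (subst add.commute) (rule sum.subset_diff[OF qp fin])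
  also have "(\<Sum>(x,K)\<in>p - q. f (Sup K) - f (Inf K)) \<le> (\<Sum>(x,K)\<in>p - q. \<eta> * measure lborel K)"
  proof (rule sum_mono, safe)
    fix x K assume xK: "(x, K) \<in> p" "(x, K) \<notin> q"
    obtain l s where ls: "K = {l..s}" "l \<le> x" "x \<le> s" "{l..s} \<subseteq> {u..v}" "{l..s} \<subseteq> ball x (r x)"
      using interval[OF xK(1)] by blast
    then have "f s - f l \<le> \<eta> * (s - l)"
      using xK by (intro r(3)[of x]) (auto simp: q_def)
    then show "f (Sup K) - f (Inf K) \<le> \<eta> * measure lborel K"
      using ls by simp
  qed
  also have "\<dots> \<le> (\<Sum>(x,K)\<in>p. \<eta> * measure lborel K)"
    using fin \<eta>(1) by (intro sum_mono2) auto
  also have "\<dots> = \<eta> * (v - u)"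
    using additive_content_tagged_division[of p u v] p(1) uv
    by (simp add: sum_distrib_left[symmetric] case_prod_unfold)
  also have "(\<Sum>(x,K)\<in>q. f (Sup K) - f (Inf K)) \<le> \<eta>"
  proof -
    have "q tagged_partial_division_of {u..v}"
      using tagged_partial_division_subset[of p "{u..v}" q] p(1)
      by (auto simp: q_def tagged_division_of_def)
    then have q: "q tagged_division_of (\<Union>(snd ` q))" "snd ` q division_of \<Union>(snd ` q)"
      by (rule tagged_partial_division_of_Union_self, rule partial_division_of_tagged_division)
    have sub: "\<Union>(snd ` q) \<subseteq> {u..v}" "\<Union>(snd ` q) \<subseteq> U"
      using interval r(2) by (fastforce simp: q_def)+
    have "(\<Sum>(x,K)\<in>q. f (Sup K) - f (Inf K)) \<le> (\<Sum>(x,K)\<in>q. norm (f (Sup K) - f (Inf K)))"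
      by (intro sum_mono) auto
    \<comment> \<open>Different tags may carry the same degenerate interval, so the sum can be
      re-indexed by intervals only if the summand vanishes whenever the interior is empty.
      Singletons give 0 by themselves; the conditional supplies 0 at the empty set, where
      \<open>Sup\<close> and \<open>Inf\<close> are meaningless.\<close>
    also have "\<dots> = (\<Sum>(x,K)\<in>q. if K = {} then 0 else norm (f (Sup K) - f (Inf K)))"
      using tagged_division_ofD(2)[OF q(1)] by (intro sum.cong) fastforce+
    also have "\<dots> = (\<Sum>K\<in>snd ` q. if K = {} then 0 else norm (f (Sup K) - f (Inf K)))"
      by (rule sum.over_tagged_division_lemma[OF q(1)]) (auto simp: not_less)
    also have "\<dots> = (\<Sum>K\<in>snd ` q. norm (f (Sup K) - f (Inf K)))"
      using division_ofD(3)[OF q(2)] by (intro sum.cong) auto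
    also have "\<dots> < \<eta>"
    proof -
      have "(\<Sum>k\<in>snd ` q. measure lborel k) < \<delta>"
        using division_measure_le[OF q(2) sub(2) _ Um] U(1) by simp
      then show ?thesis using \<delta>(2) q(2) sub(1) by blast
    qed
    finally show ?thesis by simp
  qed
  finally show "f v \<le> f u + e" using \<eta>(2) by simp
qed

text \<open>Projecting on the chord \<open>w = f t - f s\<close> makes the problem scalar: by
  Cauchy-Schwarz, \<open>w \<bullet> f r - norm w * B * r\<close> has nonpositive derivative.
  Comparing its values at \<open>s\<close> and \<open>t\<close> bounds the squared length of
  \<open>w\<close> by \<open>norm w * (B * (t - s))\<close>.\<close>

lemma absolutely_continuous_on_imp_lipschitz_on:
  fixes f :: "real \<Rightarrow> 'a::real_inner"
  assumes "B \<ge> 0" and ac: "absolutely_continuous_on {u..v} f"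
    and der: "AE t in lborel. t \<in> {u<..<v} \<longrightarrow> (\<exists>D. norm D \<le> B \<and> (f has_vector_derivative D) (at t))"
  shows "B-lipschitz_on {u..v} f"
proof (rule lipschitz_on_leI)
  fix s t assume st: "s \<in> {u..v}" "t \<in> {u..v}" "s \<le> t"
  define w where "w = f t - f s"
  have ac_w: "absolutely_continuous_on {s..t} (\<lambda>r. w \<bullet> f r - norm w * B * r)"
  proof (rule absolutely_continuous_on_diff)
    have "absolutely_continuous_on {s..t} (\<lambda>r. w)"
      using lipschitz_on_constant by (rule lipschitz_on_imp_absolutely_continuous_on)
    moreover have "absolutely_continuous_on {s..t} f"
      using st by (intro absolutely_continuous_on_subset[OF ac]) auto
    ultimately show "absolutely_continuous_on {s..t} (\<lambda>r. w \<bullet> f r)"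
      by (rule absolutely_continuous_on_inner)
    have "\<bar>norm w * B\<bar>-lipschitz_on {s..t} (\<lambda>r. norm w * B * r)"
      using lipschitz_on_cmult_real[OF lipschitz_on_id, of "norm w * B"] by simp
    then show "absolutely_continuous_on {s..t} (\<lambda>r. norm w * B * r)"
      by (rule lipschitz_on_imp_absolutely_continuous_on)
  qed
  have "w \<bullet> f t - norm w * B * t \<le> w \<bullet> f s - norm w * B * s"
  proof (rule absolutely_continuous_on_nonincreasing[OF st(3) ac_w])
    show "AE r in lborel. r \<in> {s<..<t} \<longrightarrow>
        (\<exists>D\<le>0. ((\<lambda>r. w \<bullet> f r - norm w * B * r) has_real_derivative D) (at r))"
    proof (rule AE_mp[OF der], rule AE_I2, safe)
      fix r D assume "r \<in> {s<..<t}" "r \<notin> {u<..<v}"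
      then show "\<exists>D\<le>0. ((\<lambda>r. w \<bullet> f r - norm w * B * r) has_real_derivative D) (at r)"
        using st by auto
    next
      fix r D assume D: "norm D \<le> B" "(f has_vector_derivative D) (at r)"
      have "w \<bullet> D \<le> norm w * norm D" by (rule norm_cauchy_schwarz)
      also have "\<dots> \<le> norm w * B" using D by (intro mult_left_mono) auto
      finally have "w \<bullet> D - norm w * B \<le> 0" by simp
      moreover have "((\<lambda>r. w \<bullet> f r) has_real_derivative w \<bullet> D) (at r)"
        using bounded_linear.has_vector_derivative[OF bounded_linear_inner_right D(2)]
        by (simp add: has_real_derivative_iff_has_vector_derivative)
      then have "((\<lambda>r. w \<bullet> f r - norm w * B * r) has_real_derivative w \<bullet> D - norm w * B) (at r)"
        by (auto intro!: derivative_eq_intros)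
      ultimately show "\<exists>D\<le>0. ((\<lambda>r. w \<bullet> f r - norm w * B * r) has_real_derivative D) (at r)" by blast
    qed
  qed
  then have "w \<bullet> (f t - f s) \<le> norm w * (B * (t - s))" by (simp add: algebra_simps)
  then have "norm w * norm w \<le> norm w * (B * (t - s))"
    unfolding w_def by (simp add: dot_square_norm power2_eq_square)
  then have "norm w \<le> B * (t - s)"
    using assms(1) st(3) by (cases "w = 0") auto
  then show "dist (f s) (f t) \<le> B * dist s t"
    using st(3) by (simp add: w_def dist_norm norm_minus_commute)
qed (fact assms(1))

section \<open>Dissipative differential inclusions\<close>

lemma AE_interior:
  fixes I :: "real set"
  assumes "convex I"
  shows "AE t in lborel. t \<in> I \<longrightarrow> t \<in> interior I"
proof -
  have "frontier I \<in> null_sets lborel"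
    using negligible_convex_frontier[OF assms]
    by (simp add: negligible_iff_null_sets null_sets_completion_iff)
  then show ?thesis
    by (rule AE_mp[OF AE_not_in], intro AE_I2) (use closure_subset[of I] in \<open>auto simp: frontier_def\<close>)
qed

text \<open>The frontier of an interval is null, so the derivative relative to \<open>I\<close> may
  be replaced by the two-sided one. The latter does not depend on \<open>I\<close> and survives
  changes of the function outside an open neighbourhood, which restriction and gluing rely
  on.\<close>

lemma filippov_solution_iff_interior:
  assumes "convex I"
  shows "filippov_solution F I x \<longleftrightarrow> locally_absolutely_continuous_on I x \<and>
    (AE t in lborel. t \<in> interior I \<longrightarrow> (\<exists>v\<in>F (x t). (x has_vector_derivative v) (at t)))"
proof -
  have "(AE t in lborel. t \<in> I \<longrightarrow> (\<exists>v\<in>F (x t). (x has_vector_derivative v) (at t within I))) \<longleftrightarrow>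
      (AE t in lborel. t \<in> interior I \<longrightarrow> (\<exists>v\<in>F (x t). (x has_vector_derivative v) (at t)))"
  proof (rule eventually_subst[OF eventually_mono[OF AE_interior[OF assms]]])
    fix t assume t: "t \<in> I \<longrightarrow> t \<in> interior I"
    show "(t \<in> I \<longrightarrow> (\<exists>v\<in>F (x t). (x has_vector_derivative v) (at t within I))) =
        (t \<in> interior I \<longrightarrow> (\<exists>v\<in>F (x t). (x has_vector_derivative v) (at t)))"
    proof (cases "t \<in> interior I")
      case True
      then have "t \<in> I" using interior_subset by blast
      with True show ?thesis by (simp add: at_within_interior[OF True])
    next
      case False
      with t show ?thesis by simp
    qed
  qed
  then show ?thesis by (simp only: filippov_solution_def)
qed

lemma filippov_solution_subset:
  assumes "filippov_solution F J x" "I \<subseteq> J"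
  shows "filippov_solution F I x"
proof -
  have "AE t in lborel. t \<in> J \<longrightarrow> (\<exists>v\<in>F (x t). (x has_vector_derivative v) (at t within J))"
    using assms(1) by (simp add: filippov_solution_def)
  then have "AE t in lborel. t \<in> I \<longrightarrow> (\<exists>v\<in>F (x t). (x has_vector_derivative v) (at t within I))"
    by (elim eventually_mono) (use assms(2) has_vector_derivative_within_subset in blast)
  moreover have "locally_absolutely_continuous_on I x"
    using assms unfolding filippov_solution_def locally_absolutely_continuous_on_def by blast
  ultimately show ?thesis by (simp add: filippov_solution_def)
qed

lemma filippov_solution_cong:
  assumes I: "convex I" and eq: "\<And>t. t \<in> I \<Longrightarrow> x t = z t" and x: "filippov_solution F I x"
  shows "filippov_solution F I z"
proof -
  have "AE t in lborel. t \<in> interior I \<longrightarrow> (\<exists>v\<in>F (x t). (x has_vector_derivative v) (at t))"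
    using x by (simp add: filippov_solution_iff_interior[OF I])
  then have "AE t in lborel. t \<in> interior I \<longrightarrow> (\<exists>v\<in>F (z t). (z has_vector_derivative v) (at t))"
  proof (elim eventually_mono, intro impI)
    fix t assume t: "t \<in> interior I" and
      "t \<in> interior I \<longrightarrow> (\<exists>v\<in>F (x t). (x has_vector_derivative v) (at t))"
    then obtain v where v: "v \<in> F (x t)" "(x has_vector_derivative v) (at t)" by blast
    have eq': "x s = z s" if "s \<in> interior I" for s
      using that interior_subset eq by blast
    have "(z has_vector_derivative v) (at t)"
      by (rule has_vector_derivative_transform_within_open[OF v(2) open_interior t eq'])
    then show "\<exists>v\<in>F (z t). (z has_vector_derivative v) (at t)"
      using v(1) eq'[OF t] by auto
  qed
  moreover have "absolutely_continuous_on {u..v} z" if "{u..v} \<subseteq> I" for u v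
  proof (rule absolutely_continuous_on_cong)
    show "absolutely_continuous_on {u..v} x"
      using x that by (simp add: filippov_solution_def locally_absolutely_continuous_on_def)
    show "x t = z t" if "t \<in> {u..v}" for t
      using eq that \<open>{u..v} \<subseteq> I\<close> by blast
  qed
  ultimately show ?thesis
    by (simp add: filippov_solution_iff_interior[OF I] locally_absolutely_continuous_on_def)
qed

section \<open>Solutions from smooth curves and from countable unions of intervals\<close>

lemma continuous_derivative_imp_lipschitz:
  fixes f :: "real \<Rightarrow> 'a::real_normed_vector"
  assumes der: "\<And>t. (f has_vector_derivative f' t) (at t)" and cont: "continuous_on {u..v} f'"
  obtains C where "C-lipschitz_on {u..v} f"
proof -
  have "bounded (f' ` {u..v})"
    using cont by (intro compact_imp_bounded compact_continuous_image) auto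
  then obtain B where B: "B > 0" "\<forall>y\<in>f' ` {u..v}. norm y \<le> B"
    unfolding bounded_pos by blast
  have "B-lipschitz_on {u..v} f"
  proof (rule bounded_derivative_imp_lipschitz)
    show "(f has_derivative (\<lambda>h. h *\<^sub>R f' t)) (at t within {u..v})" for t
      using der[of t] has_derivative_at_withinI by (auto simp: has_vector_derivative_def)
    show "onorm (\<lambda>h. h *\<^sub>R f' t) \<le> B" if "t \<in> {u..v}" for t
      using B that by (intro onorm_le) (auto simp: mult.commute[of B] intro!: mult_left_mono)
  qed (use B in auto)
  then show ?thesis by (rule that)
qed

text \<open>The inclusion is asked for on the open interval alone, because the explicit relay
  solutions have a controlled sign of the third coordinate only there.\<close>

lemma filippov_solution_of_derivative:
  fixes x :: "real \<Rightarrow> 'a::euclidean_space"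
  assumes der: "\<And>t. (x has_vector_derivative x' t) (at t)" and cont: "continuous_on {u..v} x'"
    and F: "\<And>t. t \<in> {u<..<v} \<Longrightarrow> x' t \<in> F (x t)"
  shows "filippov_solution F {u..v} x"
proof -
  obtain C where "C-lipschitz_on {u..v} x"
    using continuous_derivative_imp_lipschitz[OF der cont] by blast
  then have "locally_absolutely_continuous_on {u..v} x"
    unfolding locally_absolutely_continuous_on_def
    using lipschitz_on_imp_absolutely_continuous_on absolutely_continuous_on_subset by blast
  then show ?thesis
    using F der by (auto simp: filippov_solution_iff_interior intro!: AE_I2)
qed

text \<open>Each \<open>T\<close> has its own exceptional set; countability of \<open>D\<close>
  keeps their union null. This carries the inclusion to a limit time and to infinity.\<close>

lemma AE_filippov_solution_Union:
  assumes "countable D" "\<And>T. T \<in> D \<Longrightarrow> filippov_solution F {u..T} x"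
  shows "AE t in lborel. t \<in> (\<Union>T\<in>D. {u<..<T}) \<longrightarrow> (\<exists>v\<in>F (x t). (x has_vector_derivative v) (at t))"
proof -
  have "AE t in lborel. \<forall>T\<in>D. t \<in> {u<..<T} \<longrightarrow> (\<exists>v\<in>F (x t). (x has_vector_derivative v) (at t))"
    unfolding AE_ball_countable[OF assms(1)]
  proof
    fix T assume "T \<in> D"
    then show "AE t in lborel. t \<in> {u<..<T} \<longrightarrow> (\<exists>v\<in>F (x t). (x has_vector_derivative v) (at t))"
      using assms(2)[of T] filippov_solution_iff_interior[of "{u..T}" F x] by simp
  qed
  then show ?thesis by (elim eventually_mono) blast
qed

text \<open>The first condition compares solutions, the third provides the zero solution to compare
  with, and the second turns a bound on a trajectory into a bound on its speed.\<close>

locale dissipative_inclusion =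
  fixes F :: "'a::euclidean_space \<Rightarrow> 'a set" and L :: real
  assumes one_sided_lipschitz:
      "\<And>x z v w. v \<in> F x \<Longrightarrow> w \<in> F z \<Longrightarrow> (x - z) \<bullet> (v - w) \<le> L * (norm (x - z))\<^sup>2"
    and locally_bounded: "\<And>R. \<exists>B. \<forall>x v. norm x \<le> R \<longrightarrow> v \<in> F x \<longrightarrow> norm v \<le> B"
    and zero_equilibrium: "0 \<in> F 0"
begin

text \<open>Gronwall by an integrating factor: the squared distance grows at rate at most
  \<open>2 * L\<close> times itself, so its product \<open>\<phi>\<close> with
  \<open>exp (- 2 * L * r)\<close> is nonincreasing.\<close>

lemma filippov_solution_dist_le:
  assumes x: "filippov_solution F {s..t} x" and z: "filippov_solution F {s..t} z" and st: "s \<le> t"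
  shows "norm (x t - z t) \<le> exp (L * (t - s)) * norm (x s - z s)"
proof -
  define \<phi> where "\<phi> = (\<lambda>r. exp (- 2 * L * r) * ((x r - z r) \<bullet> (x r - z r)))"
  have "absolutely_continuous_on {s..t} x" "absolutely_continuous_on {s..t} z"
    using x z by (auto simp: filippov_solution_def locally_absolutely_continuous_on_def)
  then have d: "absolutely_continuous_on {s..t} (\<lambda>r. x r - z r)"
    by (rule absolutely_continuous_on_diff)
  obtain C where "C-lipschitz_on {s..t} (\<lambda>r. exp (- 2 * L * r))"
  proof (rule continuous_derivative_imp_lipschitz)
    show "((\<lambda>r. exp (- 2 * L * r)) has_vector_derivative (- 2 * L) * exp (- 2 * L * r)) (at r)" for r
      unfolding has_real_derivative_iff_has_vector_derivative[symmetric]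
      by (auto intro!: derivative_eq_intros)
  qed (auto intro!: continuous_intros)
  then have e: "absolutely_continuous_on {s..t} (\<lambda>r. exp (- 2 * L * r))"
    by (rule lipschitz_on_imp_absolutely_continuous_on)
  have ac: "absolutely_continuous_on {s..t} \<phi>"
    unfolding \<phi>_def by (intro absolutely_continuous_on_mult absolutely_continuous_on_inner d e)
  have ae: "AE r in lborel. r \<in> {s<..<t} \<longrightarrow> (\<exists>v\<in>F (x r). (x has_vector_derivative v) (at r))"
    "AE r in lborel. r \<in> {s<..<t} \<longrightarrow> (\<exists>v\<in>F (z r). (z has_vector_derivative v) (at r))"
    using x z by (simp_all add: filippov_solution_iff_interior)
  have "\<phi> t \<le> \<phi> s"
  proof (rule absolutely_continuous_on_nonincreasing[OF st ac])
    show "AE r in lborel. r \<in> {s<..<t} \<longrightarrow> (\<exists>D\<le>0. (\<phi> has_real_derivative D) (at r))"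
      using ae
    proof eventually_elim
      case (elim r)
      show ?case
      proof
        assume "r \<in> {s<..<t}"
        then obtain v w where v: "v \<in> F (x r)" "(x has_vector_derivative v) (at r)"
          and w: "w \<in> F (z r)" "(z has_vector_derivative w) (at r)"
          using elim by blast
        \<comment> \<open>The derivative of \<open>\<phi>\<close> with its positive factor pulled
          out; what remains is the defect in the one-sided Lipschitz condition.\<close>
        define D where "D = 2 * exp (- 2 * L * r) * ((x r - z r) \<bullet> (v - w) - L * (norm (x r - z r))\<^sup>2)"
        have d: "((\<lambda>r. x r - z r) has_vector_derivative v - w) (at r)"
          using v(2) w(2) by (rule has_vector_derivative_diff)
        have i: "((\<lambda>r. (x r - z r) \<bullet> (x r - z r)) has_real_derivative
            (x r - z r) \<bullet> (v - w) + (v - w) \<bullet> (x r - z r)) (at r)"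
          using bounded_bilinear.has_vector_derivative[OF bounded_bilinear_inner d d]
          by (simp add: has_real_derivative_iff_has_vector_derivative)
        have e: "((\<lambda>r. exp (- 2 * L * r)) has_real_derivative (- 2 * L) * exp (- 2 * L * r)) (at r)"
          by (auto intro!: derivative_eq_intros)
        have "(- 2 * L) * exp (- 2 * L * r) * ((x r - z r) \<bullet> (x r - z r)) +
            ((x r - z r) \<bullet> (v - w) + (v - w) \<bullet> (x r - z r)) * exp (- 2 * L * r) = D"
          unfolding D_def power2_norm_eq_inner inner_commute[of "v - w"]
          by (simp add: right_diff_distrib)
        with DERIV_mult[OF e i] have "(\<phi> has_real_derivative D) (at r)"
          unfolding \<phi>_def by (rule DERIV_cong)
        moreover have "D \<le> 0"
          using one_sided_lipschitz[OF v(1) w(1)] by (simp add: D_def mult_nonneg_nonpos)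
        ultimately show "\<exists>D\<le>0. (\<phi> has_real_derivative D) (at r)" by blast
      qed
    qed
  qed
  have "(norm (x t - z t))\<^sup>2 = exp (2 * L * t) * \<phi> t"
    by (simp add: \<phi>_def power2_norm_eq_inner mult.assoc[symmetric] exp_add[symmetric])
  also have "\<dots> \<le> exp (2 * L * t) * \<phi> s"
    using \<open>\<phi> t \<le> \<phi> s\<close> by simp
  also have "\<dots> = (exp (L * (t - s)) * norm (x s - z s))\<^sup>2"
    by (simp add: \<phi>_def power2_norm_eq_inner power_mult_distrib mult.assoc[symmetric]
        exp_add[symmetric] exp_double[symmetric] right_diff_distrib)
  finally show ?thesis by (rule power2_le_imp_le) simp
qed

text \<open>The distance estimate runs forward in time only, hence \<open>s \<le> t\<close>;
  convexity puts the whole segment between them into \<open>I\<close>.\<close>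

lemma filippov_solution_unique:
  assumes "filippov_solution F I x" "filippov_solution F I z" "convex I"
    and "s \<in> I" "t \<in> I" "s \<le> t" "x s = z s"
  shows "x t = z t"
proof -
  have "{s..t} \<subseteq> I"
    using assms(3-5) by (metis closed_segment_eq_real_ivl convex_contains_segment assms(6))
  then have "norm (x t - z t) \<le> exp (L * (t - s)) * norm (x s - z s)"
    using assms by (intro filippov_solution_dist_le) (auto intro: filippov_solution_subset)
  then show ?thesis using assms(7) by simp
qed

lemma filippov_solution_norm_le:
  assumes "filippov_solution F {s..t} x" "s \<le> t"
  shows "norm (x t) \<le> exp (L * (t - s)) * norm (x s)"
proof -
  have "absolutely_continuous_on {u..v} (\<lambda>t. 0::'a)" for u v
    using lipschitz_on_constant by (rule lipschitz_on_imp_absolutely_continuous_on)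
  then have "filippov_solution F {s..t} (\<lambda>t. 0)"
    using zero_equilibrium
    by (auto simp: filippov_solution_def locally_absolutely_continuous_on_def intro!: AE_I2 bexI[of _ 0])
  from filippov_solution_dist_le[OF assms(1) this assms(2)] show ?thesis by simp
qed

section \<open>Uniform Lipschitz bounds, gluing and continuation\<close>

lemma filippov_solution_lipschitz:
  assumes "\<And>t. t \<in> {u..v} \<Longrightarrow> norm (x t) \<le> R" and "B \<ge> 0"
    and "\<And>p w. norm p \<le> R \<Longrightarrow> w \<in> F p \<Longrightarrow> norm w \<le> B"
    and x: "filippov_solution F {u..v} x"
  shows "B-lipschitz_on {u..v} x"
proof (rule absolutely_continuous_on_imp_lipschitz_on[OF assms(2)])
  show "absolutely_continuous_on {u..v} x"
    using x by (auto simp: filippov_solution_def locally_absolutely_continuous_on_def)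
  have "AE t in lborel. t \<in> {u<..<v} \<longrightarrow> (\<exists>v\<in>F (x t). (x has_vector_derivative v) (at t))"
    using x by (simp add: filippov_solution_iff_interior)
  then show "AE t in lborel. t \<in> {u<..<v} \<longrightarrow> (\<exists>D. norm D \<le> B \<and> (x has_vector_derivative D) (at t))"
  proof (elim eventually_mono, intro impI)
    fix t assume t: "t \<in> {u<..<v}"
      and "t \<in> {u<..<v} \<longrightarrow> (\<exists>v\<in>F (x t). (x has_vector_derivative v) (at t))"
    then obtain w where "w \<in> F (x t)" "(x has_vector_derivative w) (at t)" by blast
    moreover have "norm (x t) \<le> R" using t assms(1) by simp
    ultimately show "\<exists>D. norm D \<le> B \<and> (x has_vector_derivative D) (at t)"
      using assms(3) by blast
  qed
qed

text \<open>The point is uniformity: one \<open>B\<close> serves all solutions from \<open>p\<close>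
  and all end times up to \<open>T\<close>, so it survives a limit of end times.\<close>

lemma filippov_solution_lipschitz_bound:
  obtains B where "\<And>v x. v \<le> T \<Longrightarrow> filippov_solution F {u..v} x \<Longrightarrow> x u = p \<Longrightarrow> B-lipschitz_on {u..v} x"
proof -
  \<comment> \<open>With \<open>\<bar>L\<bar>\<close> the exponential dominates its values at all
    earlier times, even for negative \<open>L\<close>.\<close>
  define R where "R = exp (\<bar>L\<bar> * (T - u)) * norm p"
  obtain B where B: "\<forall>x v. norm x \<le> R \<longrightarrow> v \<in> F x \<longrightarrow> norm v \<le> B"
    using locally_bounded by blast
  show ?thesis
  proof (rule that[of "\<bar>B\<bar>"])
    fix v x assume v: "v \<le> T" and x: "filippov_solution F {u..v} x" "x u = p"
    have "norm (x t) \<le> R" if t: "t \<in> {u..v}" for t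
    proof -
      have "norm (x t) \<le> exp (L * (t - u)) * norm (x u)"
        using t by (intro filippov_solution_norm_le filippov_solution_subset[OF x(1)]) auto
      also have "\<dots> \<le> R"
        unfolding R_def x(2) using t v by (intro mult_right_mono) (auto intro!: mult_mono)
      finally show ?thesis .
    qed
    then show "\<bar>B\<bar>-lipschitz_on {u..v} x"
      using B x(1) by (intro filippov_solution_lipschitz[where R = R]) force+
  qed
qed

text \<open>Both pieces are Lipschitz, and Lipschitz curves that meet can be concatenated, which
  yields absolute continuity. At the junction \<open>v\<close> the one-sided derivatives may differ,
  but a single time is null.\<close>

lemma filippov_solution_concat:
  assumes x: "filippov_solution F {u..v} x" and y: "filippov_solution F {v..w} y"
    and xy: "x v = y v" and uvw: "u \<le> v" "v \<le> w"
  shows "filippov_solution F {u..w} (\<lambda>t. if t \<le> v then x t else y t)" (is "filippov_solution F _ ?z")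
proof -
  obtain B where B: "\<And>r z. r \<le> v \<Longrightarrow> filippov_solution F {u..r} z \<Longrightarrow> z u = x u \<Longrightarrow> B-lipschitz_on {u..r} z"
    using filippov_solution_lipschitz_bound[of v u "x u"] by blast
  obtain C where C: "\<And>r z. r \<le> w \<Longrightarrow> filippov_solution F {v..r} z \<Longrightarrow> z v = y v \<Longrightarrow> C-lipschitz_on {v..r} z"
    using filippov_solution_lipschitz_bound[of w v "y v"] by blast
  have "(max B C)-lipschitz_on {u..v} x" "(max B C)-lipschitz_on {v..w} y"
    using B[OF order_refl x refl] C[OF order_refl y refl] by (auto intro: lipschitz_on_mono)
  then have "(max B C)-lipschitz_on {u..w} ?z"
    using xy by (rule lipschitz_on_concat)
  then have "locally_absolutely_continuous_on {u..w} ?z"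
    unfolding locally_absolutely_continuous_on_def
    using lipschitz_on_imp_absolutely_continuous_on absolutely_continuous_on_subset by blast
  moreover have "AE t in lborel. t \<in> {u<..<w} \<longrightarrow> (\<exists>v\<in>F (?z t). (?z has_vector_derivative v) (at t))"
  proof -
    have "AE t in lborel. t \<in> {u<..<v} \<longrightarrow> (\<exists>v\<in>F (x t). (x has_vector_derivative v) (at t))"
      "AE t in lborel. t \<in> {v<..<w} \<longrightarrow> (\<exists>v\<in>F (y t). (y has_vector_derivative v) (at t))"
      using x y by (simp_all add: filippov_solution_iff_interior)
    then show ?thesis using AE_lborel_singleton[of v]
    proof eventually_elim
      case (elim t)
      show ?case
      proof
        assume t: "t \<in> {u<..<w}"
        consider "t < v" | "t > v" using elim(3) by linarith
        then show "\<exists>v\<in>F (?z t). (?z has_vector_derivative v) (at t)"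
        proof cases
          case 1
          then obtain D where D: "D \<in> F (x t)" "(x has_vector_derivative D) (at t)"
            using elim(1) t by auto
          have "(?z has_vector_derivative D) (at t)"
            by (rule has_vector_derivative_transform_within_open[OF D(2), of "{..<v}"]) (use 1 in auto)
          then show ?thesis using D(1) 1 by auto
        next
          case 2
          then obtain D where D: "D \<in> F (y t)" "(y has_vector_derivative D) (at t)"
            using elim(2) t by auto
          have "(?z has_vector_derivative D) (at t)"
            by (rule has_vector_derivative_transform_within_open[OF D(2), of "{v<..}"]) (use 2 in auto)
          then show ?thesis using D(1) 2 by auto
        qed
      qed
    qed
  qed
  ultimately show ?thesis by (simp add: filippov_solution_iff_interior)
qed

text \<open>The family \<open>X\<close> is chosen separately for each end time. Forward uniqueness
  makes its members agree where they overlap, so the diagonal is one curve that equals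
  \<open>X T\<close> on \<open>{u..T}\<close>.\<close>

lemma filippov_solution_diagonal:
  assumes "u \<le> T"
    and X: "\<And>t. u \<le> t \<Longrightarrow> t \<le> T \<Longrightarrow> filippov_solution F {u..t} (X t) \<and> X t u = p"
  shows "filippov_solution F {u..T} (\<lambda>t. X t t)"
proof (rule filippov_solution_cong[where x = "X T"])
  show "X T t = X t t" if "t \<in> {u..T}" for t
  proof (rule filippov_solution_unique[where I = "{u..t}" and s = u and x = "X T" and z = "X t" and t = t])
    show "filippov_solution F {u..t} (X T)" "filippov_solution F {u..t} (X t)"
      using X[of T] X[of t] that filippov_solution_subset[of F "{u..T}" "X T" "{u..t}"] by auto
    show "X T u = X t u" using X[of T] X[of t] that by simp
  qed (use that in auto)
qed (use X[of T] assms(1) in auto)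

lemma filippov_solution_closure:
  assumes ex: "\<And>T. u \<le> T \<Longrightarrow> T < w \<Longrightarrow> \<exists>x. filippov_solution F {u..T} x \<and> x u = p" and uw: "u < w"
  shows "\<exists>x. filippov_solution F {u..w} x \<and> x u = p"
  \<comment> \<open>the solutions on \<open>{u..T}\<close> share one Lipschitz constant, so their union extends to \<open>w\<close>\<close>
proof -
  obtain X where X: "\<And>T. u \<le> T \<Longrightarrow> T < w \<Longrightarrow> filippov_solution F {u..T} (X T) \<and> X T u = p"
    using ex by metis
  define x where "x t = X t t" for t
  have xsol: "filippov_solution F {u..T} x" if "u \<le> T" "T < w" for T
    unfolding x_def using X that by (intro filippov_solution_diagonal) auto
  have xu: "x u = p" using X[of u] uw by (simp add: x_def)
  obtain B where B: "\<And>v z. v \<le> w \<Longrightarrow> filippov_solution F {u..v} z \<Longrightarrow> z u = p \<Longrightarrow> B-lipschitz_on {u..v} z"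
    using filippov_solution_lipschitz_bound[of w u p] by blast
  have Bx: "B-lipschitz_on {u..T} x" if "u \<le> T" "T < w" for T
    using B xsol[OF that] xu that by simp
  have "B-lipschitz_on {u..<w} x"
  proof (rule lipschitz_on_leI)
    show "dist (x s) (x t) \<le> B * dist s t" if "s \<in> {u..<w}" "t \<in> {u..<w}" "s \<le> t" for s t
      using lipschitz_onD[OF Bx[of t], of s t] that by simp
    show "0 \<le> B" using lipschitz_on_nonneg[OF Bx[of u]] uw by simp
  qed
  \<comment> \<open>The closure of \<open>{u..<w}\<close> adds only \<open>w\<close>, so the
    extension merely supplies the limit value there.\<close>
  from lipschitz_extend_closure[OF this]
  obtain g where g: "B-lipschitz_on {u..w} g" "\<And>t. t \<in> {u..<w} \<Longrightarrow> g t = x t"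
    using uw by auto
  have gsol: "filippov_solution F {u..T} g" if "u \<le> T" "T < w" for T
    by (rule filippov_solution_cong[OF _ _ xsol[OF that]]) (use g(2) that in auto)
  \<comment> \<open>Countably many end times that increase to \<open>w\<close> and exhaust the open
    interval.\<close>
  define D where "D = {w - inverse (real (Suc n)) |n. u \<le> w - inverse (real (Suc n))}"
  have "AE t in lborel. t \<in> (\<Union>T\<in>D. {u<..<T}) \<longrightarrow> (\<exists>v\<in>F (g t). (g has_vector_derivative v) (at t))"
  proof (rule AE_filippov_solution_Union)
    show "countable D" unfolding D_def by (rule countable_subset[of _ "range (\<lambda>n. w - inverse (real (Suc n)))"]) auto
  qed (auto simp: D_def intro!: gsol)
  moreover have "{u<..<w} \<subseteq> (\<Union>T\<in>D. {u<..<T})"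
  proof
    fix t assume t: "t \<in> {u<..<w}"
    then obtain n where "inverse (real (Suc n)) < w - t"
      using reals_Archimedean[of "w - t"] by auto
    then show "t \<in> (\<Union>T\<in>D. {u<..<T})"
      using t by (auto simp: D_def intro!: exI[of _ "w - inverse (real (Suc n))"] exI[of _ n])
  qed
  ultimately have "AE t in lborel. t \<in> {u<..<w} \<longrightarrow> (\<exists>v\<in>F (g t). (g has_vector_derivative v) (at t))"
    by (elim eventually_mono) blast
  moreover have "locally_absolutely_continuous_on {u..w} g"
    unfolding locally_absolutely_continuous_on_def
    using g(1) lipschitz_on_imp_absolutely_continuous_on absolutely_continuous_on_subset by blast
  ultimately have "filippov_solution F {u..w} g"
    by (simp add: filippov_solution_iff_interior)
  moreover have "g u = p" using g(2)[of u] xu uw by simp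
  ultimately show ?thesis by blast
qed

theorem filippov_solution_exists:
  assumes local: "\<And>q s. \<exists>h>0. \<exists>y. filippov_solution F {s..s + h} y \<and> y s = q"
  shows "\<exists>x. filippov_solution F {u..} x \<and> x u = p"
proof -
  define Q where "Q T \<longleftrightarrow> (\<exists>x. filippov_solution F {u..T} x \<and> x u = p)" for T
  have Q_mono: "Q S" if "Q T" "S \<le> T" for S T
    using that filippov_solution_subset[of F "{u..T}" _ "{u..S}"] unfolding Q_def by auto
  have "Q u"
  proof -
    obtain h y where "h > 0" "filippov_solution F {u..u + h} y" "y u = p" using local by blast
    then show ?thesis using Q_mono[of "u + h" u] unfolding Q_def by auto
  qed
  have all: "Q T" if "u \<le> T" for T
  proof (rule ccontr)
    assume "\<not> Q T"
    \<comment> \<open>Existence up to a time implies existence up to every earlier one, so failure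
      at \<open>T\<close> bounds \<open>S\<close>. Its supremum is then attained and
      exceeded.\<close>
    define S where "S = {r. u \<le> r \<and> Q r}"
    have bdd: "bdd_above S"
    proof (rule bdd_aboveI)
      show "r \<le> T" if "r \<in> S" for r
        using \<open>\<not> Q T\<close> Q_mono[of r T] that by (cases "r \<le> T") (auto simp: S_def)
    qed
    have "u \<in> S" using \<open>Q u\<close> by (simp add: S_def)
    define w where "w = Sup S"
    have uw: "u \<le> w" unfolding w_def using \<open>u \<in> S\<close> bdd by (rule cSup_upper)
    have below: "Q r" if r: "u \<le> r" "r < w" for r
    proof -
      obtain r' where "r' \<in> S" "r < r'"
        using r(2) \<open>u \<in> S\<close> bdd less_cSup_iff[of S r] unfolding w_def by blast
      then show ?thesis using Q_mono[of r' r] by (simp add: S_def)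
    qed
    have "Q w"
    \<comment> \<open>The limit argument needs a nondegenerate interval.\<close>
    proof (cases "u = w")
      case True
      then show ?thesis using \<open>Q u\<close> by simp
    next
      case False
      then show ?thesis
        using filippov_solution_closure[of u w p] below uw unfolding Q_def by simp
    qed
    then obtain x where x: "filippov_solution F {u..w} x" "x u = p" unfolding Q_def by blast
    obtain h y where h: "h > 0" and y: "filippov_solution F {w..w + h} y" "y w = x w"
      using local by blast
    have "Q (w + h)"
      unfolding Q_def using filippov_solution_concat[OF x(1) y(1)] y(2) x(2) uw h by force
    then have "w + h \<in> S" using uw h by (simp add: S_def)
    then have "w + h \<le> w" unfolding w_def using bdd by (rule cSup_upper)
    then show False using h by simp
  qed
  then obtain X where X: "\<And>T. u \<le> T \<Longrightarrow> filippov_solution F {u..T} (X T) \<and> X T u = p"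
    unfolding Q_def by metis
  define x where "x t = X t t" for t
  have xsol: "filippov_solution F {u..T} x" if "u \<le> T" for T
    unfolding x_def using X that by (intro filippov_solution_diagonal) auto
  define D where "D = range (\<lambda>n. u + real n)"
  have "AE t in lborel. t \<in> (\<Union>T\<in>D. {u<..<T}) \<longrightarrow> (\<exists>v\<in>F (x t). (x has_vector_derivative v) (at t))"
    by (rule AE_filippov_solution_Union) (auto simp: D_def intro!: xsol)
  moreover have "{u<..} \<subseteq> (\<Union>T\<in>D. {u<..<T})"
  proof
    fix t assume t: "t \<in> {u<..}"
    obtain n where "t - u < real n" using reals_Archimedean2 by blast
    then show "t \<in> (\<Union>T\<in>D. {u<..<T})"
      using t by (auto simp: D_def intro!: exI[of _ n])
  qed
  ultimately have "AE t in lborel. t \<in> {u<..} \<longrightarrow> (\<exists>v\<in>F (x t). (x has_vector_derivative v) (at t))"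
    by (elim eventually_mono) blast
  moreover have "absolutely_continuous_on {a..b} x" if "{a..b} \<subseteq> {u..}" for a b
  proof (rule absolutely_continuous_on_subset)
    show "absolutely_continuous_on {u..max u b} x"
      using xsol[of "max u b"] by (simp add: filippov_solution_def locally_absolutely_continuous_on_def)
    show "{a..b} \<subseteq> {u..max u b}" using that by auto
  qed
  ultimately have "filippov_solution F {u..} x"
    by (simp add: filippov_solution_iff_interior locally_absolutely_continuous_on_def)
  moreover have "x u = p" using X[of u] by (simp add: x_def)
  ultimately show ?thesis by blast
qed

end

section \<open>Linear third-order equations\<close>

text \<open>The derivatives at \<open>0\<close> of a solution of \<open>y''' + a y'' + b y' + c y = 0\<close>.\<close>

fun recurrence3 :: "real \<Rightarrow> real \<Rightarrow> real \<Rightarrow> real \<Rightarrow> real \<Rightarrow> real \<Rightarrow> nat \<Rightarrow> real" where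
  "recurrence3 a b c p q r 0 = p"
| "recurrence3 a b c p q r (Suc 0) = q"
| "recurrence3 a b c p q r (Suc (Suc 0)) = r"
| "recurrence3 a b c p q r (Suc (Suc (Suc n))) = - a * recurrence3 a b c p q r (Suc (Suc n))
     - b * recurrence3 a b c p q r (Suc n) - c * recurrence3 a b c p q r n"

text \<open>Since \<open>K\<close> is at least 1 and dominates the sum of the moduli of the
  coefficients, each recurrence step costs at most one factor \<open>K\<close>. Divided by
  factorials, such terms are dominated by an exponential series.\<close>

lemma recurrence3_bound:
  fixes a b c p q r :: real
  defines "K \<equiv> 1 + \<bar>a\<bar> + \<bar>b\<bar> + \<bar>c\<bar>" and "M \<equiv> \<bar>p\<bar> + \<bar>q\<bar> + \<bar>r\<bar>"
  shows "\<bar>recurrence3 a b c p q r n\<bar> \<le> M * K ^ n"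
proof (induction n rule: less_induct)
  case (less n)
  have K: "K \<ge> 1" "M \<ge> 0" by (simp_all add: K_def M_def)
  have base: "M \<le> M * K ^ m" for m
    using K by (simp add: mult_le_cancel_left1)
  consider "n = 0" | "n = 1" | "n = 2" | m where "n = Suc (Suc (Suc m))"
    by (metis One_nat_def Suc_1 not0_implies_Suc)
  then show ?case
  proof cases
    case 4
    let ?e = "recurrence3 a b c p q r"
    have e: "\<bar>?e k\<bar> \<le> M * K ^ (m + 2)" if "k < n" "k \<le> m + 2" for k :: nat
    proof -
      have "\<bar>?e k\<bar> \<le> M * K ^ k" using less that by blast
      also have "\<dots> \<le> M * K ^ (m + 2)" using K that by (intro mult_left_mono power_increasing) auto
      finally show ?thesis .
    qed
    have "\<bar>?e n\<bar> \<le> \<bar>a\<bar> * \<bar>?e (Suc (Suc m))\<bar> + \<bar>b\<bar> * \<bar>?e (Suc m)\<bar> + \<bar>c\<bar> * \<bar>?e m\<bar>"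
      unfolding 4 abs_mult[symmetric] recurrence3.simps by linarith
    also have "\<dots> \<le> \<bar>a\<bar> * (M * K ^ (m + 2)) + \<bar>b\<bar> * (M * K ^ (m + 2)) + \<bar>c\<bar> * (M * K ^ (m + 2))"
      using 4 by (intro add_mono mult_left_mono e) auto
    also have "\<dots> = (\<bar>a\<bar> + \<bar>b\<bar> + \<bar>c\<bar>) * (M * K ^ (m + 2))" by (simp add: algebra_simps)
    also have "\<dots> \<le> K * (M * K ^ (m + 2))"
      using K by (intro mult_right_mono) (auto simp: K_def)
    also have "\<dots> = M * K ^ n" by (simp add: 4)
    finally show ?thesis .
  qed (rule order_trans[OF _ base], simp add: M_def numeral_2_eq_2)+
qed

text \<open>Subtracting the stationary value \<open>d / c\<close> makes the equation homogeneous.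
  Its solution is the Taylor series at 0 with derivatives \<open>?e n\<close>, and
  \<open>S k\<close> is the \<open>k\<close>-th derivative of that series.\<close>

lemma linear_ode3_exists:
  fixes a b c d p q r :: real
  assumes "c \<noteq> 0"
  obtains f g h where "f 0 = p" "g 0 = q" "h 0 = r"
    "\<And>t. (f has_real_derivative g t) (at t)" "\<And>t. (g has_real_derivative h t) (at t)"
    "\<And>t. (h has_real_derivative d - c * f t - b * g t - a * h t) (at t)"
proof -
  let ?e = "recurrence3 a b c (p - d / c) q r"
  define K where "K = 1 + \<bar>a\<bar> + \<bar>b\<bar> + \<bar>c\<bar>"
  define M where "M = \<bar>p - d / c\<bar> + \<bar>q\<bar> + \<bar>r\<bar>"
  define C where "C k n = ?e (n + k) / fact n" for k n
  define S where "S k t = (\<Sum>n. C k n * t ^ n)" for k t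
  have summ: "summable (\<lambda>n. C k n * t ^ n)" for k t
  proof (rule summable_comparison_test')
    show "summable (\<lambda>n. M * K ^ k * ((K * \<bar>t\<bar>) ^ n / fact n))"
      using summable_exp_generic[of "K * \<bar>t\<bar>"] by (intro summable_mult) (simp add: field_simps)
    show "norm (C k n * t ^ n) \<le> M * K ^ k * ((K * \<bar>t\<bar>) ^ n / fact n)" for n
    proof -
      have "\<bar>?e (n + k)\<bar> * (\<bar>t\<bar> ^ n / fact n) \<le> M * K ^ (n + k) * (\<bar>t\<bar> ^ n / fact n)"
        unfolding M_def K_def by (intro mult_right_mono recurrence3_bound) auto
      then show ?thesis
        by (simp add: C_def abs_mult power_abs power_add power_mult_distrib mult_ac)
    qed
  qed
  \<comment> \<open>Termwise differentiation merely shifts the recurrence index.\<close>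
  have diffs: "diffs (C k) = C (Suc k)" for k
    by (simp add: diffs_def C_def fun_eq_iff del: of_nat_Suc)
  have der: "(S k has_real_derivative S (Suc k) t) (at t)" for k t
    using termdiffs_strong_converges_everywhere[OF summ[of k]] unfolding S_def diffs by simp
  have S0: "S k 0 = ?e k" for k
    using powser_zero[of "C k"] by (simp add: S_def C_def)
  have S3: "S 3 t = - a * S 2 t - b * S 1 t - c * S 0 t" for t
  proof -
    have "C 3 n * t ^ n = - a * (C 2 n * t ^ n) - b * (C 1 n * t ^ n) - c * (C 0 n * t ^ n)" for n
      by (simp add: C_def numeral_3_eq_3 numeral_2_eq_2 field_simps)
    then have "S 3 t = (\<Sum>n. - a * (C 2 n * t ^ n) - b * (C 1 n * t ^ n) - c * (C 0 n * t ^ n))"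
      by (simp add: S_def)
    also have "\<dots> = - a * S 2 t - b * S 1 t - c * S 0 t"
      unfolding S_def by (simp only: suminf_mult[OF summ] suminf_diff[symmetric] summable_mult summable_diff summ)
    finally show ?thesis .
  qed
  show ?thesis
  proof (rule that[of "\<lambda>t. S 0 t + d / c" "S 1" "S 2"])
    show "S 0 0 + d / c = p" "S 1 0 = q" "S 2 0 = r"
      by (simp_all add: S0 numeral_2_eq_2)
    show "((\<lambda>t. S 0 t + d / c) has_real_derivative S 1 t) (at t)" for t
      using der[of 0 t] by (auto intro!: derivative_eq_intros)
    show "(S 1 has_real_derivative S 2 t) (at t)" for t
      using der[of 1 t] by (simp add: numeral_2_eq_2)
    show "(S 2 has_real_derivative d - c * (S 0 t + d / c) - b * S 1 t - a * S 2 t) (at t)" for t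
    proof -
      have "d - c * (S 0 t + d / c) - b * S 1 t - a * S 2 t = S 3 t"
        using S3[of t] assms by (simp add: distrib_left)
      moreover have "Suc 2 = 3" by simp
      ultimately show ?thesis using der[of 2 t] by (simp only:)
    qed
  qed
qed

section \<open>Calculus of curves in three-space by coordinates\<close>

lemma vector3_eq_axis_sum:
  "vector [u, v, w] = u *\<^sub>R axis 1 1 + v *\<^sub>R axis 2 1 + (w *\<^sub>R axis 3 1 :: real^3)"
  by (simp add: vec_eq_iff forall_3 axis_def)

lemma has_vector_derivative_vector3:
  assumes "(f has_real_derivative f') (at t)" "(g has_real_derivative g') (at t)"
    "(h has_real_derivative h') (at t)"
  shows "((\<lambda>t. vector [f t, g t, h t] :: real^3) has_vector_derivative vector [f', g', h']) (at t)"
  unfolding vector3_eq_axis_sum using assms unfolding has_real_derivative_iff_has_vector_derivative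
  by (intro has_vector_derivative_add)
    (auto intro!: bounded_linear.has_vector_derivative[OF bounded_linear_scaleR_left])

lemma continuous_on_vector3:
  assumes "continuous_on S f" "continuous_on S g" "continuous_on S h"
  shows "continuous_on S (\<lambda>t. vector [f t, g t, h t] :: real^3)"
  unfolding vector3_eq_axis_sum by (intro continuous_intros assms)

section \<open>The relay system\<close>

lemma sign_set_monotone:
  assumes "s \<in> sign_set y" "r \<in> sign_set z"
  shows "(s - r) * (y - z) \<ge> 0"
  using assms by (auto simp: sign_set_def mult_le_0_iff zero_le_mult_iff split: if_splits)

lemma sign_set_abs_le: "s \<in> sign_set y \<Longrightarrow> \<bar>s\<bar> \<le> 1"
  by (auto simp: sign_set_def split: if_splits)

lemma mem_relay_system:
  "v \<in> relay_system a b c \<gamma> x \<longleftrightarrow> (\<exists>s\<in>sign_set (x $ 3).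
    v = vector [x $ 2, x $ 3, - c * x $ 1 - b * x $ 2 - a * x $ 3 - s * \<gamma>])"
  by (auto simp: relay_system_def relay_A_mult relay_B_def vec_eq_iff forall_3)

lemma dissipative_relay_system:
  assumes "\<gamma> > 0"
  shows "dissipative_inclusion (relay_system a b c \<gamma>) (onorm ((*v) (relay_A a b c)))"
proof
  let ?A = "relay_A a b c" and ?B = "relay_B \<gamma>"
  let ?L = "onorm ((*v) ?A)"
  have A: "norm (?A *v x) \<le> ?L * norm x" for x
    by (rule onorm) simp
  fix x z v w assume "v \<in> relay_system a b c \<gamma> x" "w \<in> relay_system a b c \<gamma> z"
  then obtain s r where s: "s \<in> sign_set (x $ 3)" "v = ?A *v x - s *\<^sub>R ?B"
    and r: "r \<in> sign_set (z $ 3)" "w = ?A *v z - r *\<^sub>R ?B"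
    by (auto simp: relay_system_def)
  have "v - w = ?A *v (x - z) - (s - r) *\<^sub>R ?B"
    by (simp add: s r matrix_vector_mult_diff_distrib algebra_simps)
  \<comment> \<open>\<open>relay_B\<close> points along the very coordinate that the relay reads, so
    the relay terms collapse to the product in \<open>sign_set_monotone\<close>.\<close>
  then have "(x - z) \<bullet> (v - w) = (x - z) \<bullet> (?A *v (x - z)) - \<gamma> * ((s - r) * (x $ 3 - z $ 3))"
    by (simp add: relay_B_def inner_vec_def sum_3 right_diff_distrib mult_ac)
  also have "\<dots> \<le> (x - z) \<bullet> (?A *v (x - z))"
    using sign_set_monotone[OF s(1) r(1)] assms by simp
  also have "\<dots> \<le> norm (x - z) * norm (?A *v (x - z))"
    by (rule norm_cauchy_schwarz)
  also have "\<dots> \<le> norm (x - z) * (?L * norm (x - z))"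
    by (intro mult_left_mono A) auto
  finally show "(x - z) \<bullet> (v - w) \<le> ?L * (norm (x - z))\<^sup>2"
    by (simp add: power2_eq_square mult_ac)
next
  let ?A = "relay_A a b c" and ?B = "relay_B \<gamma>"
  let ?L = "onorm ((*v) ?A)"
  fix R
  have "norm v \<le> ?L * R + norm ?B" if "norm x \<le> R" "v \<in> relay_system a b c \<gamma> x" for x v
  proof -
    obtain s where s: "s \<in> sign_set (x $ 3)" "v = ?A *v x - s *\<^sub>R ?B"
      using \<open>v \<in> _\<close> by (auto simp: relay_system_def)
    have "norm (?A *v x) \<le> ?L * norm x" by (rule onorm) simp
    also have "\<dots> \<le> ?L * R"
      using \<open>norm x \<le> R\<close> by (intro mult_left_mono onorm_pos_le) auto
    moreover have "norm (s *\<^sub>R ?B) \<le> norm ?B"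
      using sign_set_abs_le[OF s(1)] by (simp add: mult_left_le_one_le)
    ultimately show ?thesis
      unfolding s(2) using norm_triangle_ineq4[of "?A *v x" "s *\<^sub>R ?B"] by linarith
  qed
  then show "\<exists>B. \<forall>x v. norm x \<le> R \<longrightarrow> v \<in> relay_system a b c \<gamma> x \<longrightarrow> norm v \<le> B" by blast
next
  show "0 \<in> relay_system a b c \<gamma> 0"
    by (auto simp: mem_relay_system sign_set_def vec_eq_iff forall_3 intro!: bexI[of _ 0])
qed

section \<open>Local solutions: leaving the switching surface, sliding, and the case split\<close>

lemma relay_local_solution_moving:
  fixes q :: "real^3"
  assumes c: "c > 0" and \<gamma>: "\<gamma> > 0" and \<epsilon>: "\<epsilon> \<in> {1, -1}"
    and q: "\<epsilon> * q $ 3 > 0 \<or> q $ 3 = 0 \<and> \<epsilon> * (c * q $ 1 + b * q $ 2) < - \<gamma> \<or>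
      q $ 3 = 0 \<and> \<epsilon> * (c * q $ 1 + b * q $ 2) = - \<gamma> \<and> \<epsilon> * q $ 2 < 0"
  shows "\<exists>T>0. \<exists>y. filippov_solution (relay_system a b c \<gamma>) {s..s + T} y \<and> y s = q"
proof -
  obtain f g h where init: "f 0 = q $ 1" "g 0 = q $ 2" "h 0 = q $ 3"
    and f: "\<And>t. (f has_real_derivative g t) (at t)"
    and g: "\<And>t. (g has_real_derivative h t) (at t)"
    and h: "\<And>t. (h has_real_derivative - \<epsilon> * \<gamma> - c * f t - b * g t - a * h t) (at t)"
    using linear_ode3_exists[of c "q $ 1" "q $ 2" "q $ 3" "- \<epsilon> * \<gamma>" b a] c by auto
  have cont: "isCont f t" "isCont g t" "isCont h t" for t
    using f g h DERIV_isCont by blast+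
  \<comment> \<open>With the relay frozen at \<epsilon>, \<open>k\<close> is the derivative of
    \<open>\<epsilon> * h\<close>. If \<open>q $ 3 = 0\<close>, then \<open>k 0\<close> equals -
    \<gamma> - \<epsilon> (c q1 + b q2), and if this vanishes too, the derivative of
    \<open>k\<close> at 0 is - c \<epsilon> q2. Hypothesis \<open>q\<close> thus says that the first
    nonzero term in this list is positive.\<close>
  define k where "k t = \<epsilon> * (- \<epsilon> * \<gamma> - c * f t - b * g t - a * h t)" for t
  have h': "((\<lambda>t. \<epsilon> * h t) has_real_derivative k t) (at t)" for t
    unfolding k_def by (rule DERIV_cmult[OF h])
  have \<epsilon>2: "\<epsilon> * \<epsilon> = 1" using \<epsilon> by auto
  \<comment> \<open>the three cases: \<open>\<epsilon> h\<close> is positive at \<open>0\<close>, or vanishes there with positive first derivative,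
    or vanishes to first order with positive second derivative\<close>
  have pos: "\<exists>T>0. \<forall>t. 0 < t \<and> t < T \<longrightarrow> \<epsilon> * h t > 0"
    using q
  proof (elim disjE conjE)
    assume "\<epsilon> * q $ 3 > 0"
    moreover have "isCont (\<lambda>t. \<epsilon> * h t) 0" using cont by (intro continuous_intros)
    ultimately have "\<forall>\<^sub>F t in at 0. \<epsilon> * h t > 0"
      using init by (intro order_tendstoD(1)[where y = "\<epsilon> * h 0"]) (auto simp: isCont_def)
    then obtain T where "T > 0" "\<forall>t. t \<noteq> 0 \<and> dist t 0 < T \<longrightarrow> \<epsilon> * h t > 0"
      unfolding eventually_at by auto
    then show ?thesis by (intro exI[of _ T]) auto
  next
    assume q3: "q $ 3 = 0" and "\<epsilon> * (c * q $ 1 + b * q $ 2) < - \<gamma>"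
    moreover have "k 0 = - (\<epsilon> * \<epsilon>) * \<gamma> - \<epsilon> * (c * q $ 1 + b * q $ 2) - \<epsilon> * a * q $ 3"
      by (simp add: k_def init algebra_simps)
    ultimately have "k 0 > 0" using \<epsilon>2 by simp
    then obtain T where "T > 0" "\<forall>t>0. t < T \<longrightarrow> \<epsilon> * h 0 < \<epsilon> * h (0 + t)"
      using DERIV_pos_inc_right[OF h'[of 0]] by blast
    then show ?thesis using q3 init by (intro exI[of _ T]) auto
  next
    assume q3: "q $ 3 = 0" and \<sigma>: "\<epsilon> * (c * q $ 1 + b * q $ 2) = - \<gamma>" and q2: "\<epsilon> * q $ 2 < 0"
    have "k 0 = - (\<epsilon> * \<epsilon>) * \<gamma> - \<epsilon> * (c * q $ 1 + b * q $ 2) - \<epsilon> * a * q $ 3"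
      by (simp add: k_def init algebra_simps)
    then have k0: "k 0 = 0" using \<sigma> q3 \<epsilon>2 by simp
    have "- \<epsilon> * \<gamma> - c * f 0 - b * g 0 - a * h 0 = \<epsilon> * k 0"
      by (simp only: k_def mult.assoc[symmetric] \<epsilon>2 mult_1_left)
    then have h0: "(h has_real_derivative 0) (at 0)" using h[of 0] k0 by simp
    have "(k has_real_derivative \<epsilon> * (0 - c * g 0 - b * h 0 - a * 0)) (at 0)"
      unfolding k_def
      by (intro DERIV_cmult DERIV_diff DERIV_const f g h0)
    then have "(k has_real_derivative - c * (\<epsilon> * q $ 2)) (at 0)"
      by (simp add: init q3 mult_ac)
    moreover have "- c * (\<epsilon> * q $ 2) > 0" using c q2 by (simp add: mult_pos_neg)
    ultimately obtain T where T: "T > 0" "\<forall>t>0. t < T \<longrightarrow> k 0 < k (0 + t)"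
      using DERIV_pos_inc_right by blast
    have "\<epsilon> * h t > 0" if t: "0 < t" "t < T" for t
    proof -
      \<comment> \<open>Positivity climbs back two levels: \<open>k\<close> exceeds
        \<open>k 0 = 0\<close> right after 0, hence \<open>\<epsilon> * h\<close> increases from
        0.\<close>
      have "\<epsilon> * h 0 < \<epsilon> * h t"
      proof (rule DERIV_pos_imp_increasing_open[OF t(1)])
        show "\<exists>y. ((\<lambda>t. \<epsilon> * h t) has_real_derivative y) (at r) \<and> y > 0" if "0 < r" "r < t" for r
          using h'[of r] T(2) that t(2) k0 by (intro exI[of _ "k r"]) auto
        show "continuous_on {0..t} (\<lambda>t. \<epsilon> * h t)"
          using cont by (intro continuous_at_imp_continuous_on ballI continuous_intros)
      qed
      then show ?thesis using init q3 by simp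
    qed
    then show ?thesis using T(1) by blast
  qed
  then obtain T where T: "T > 0" "\<And>t. 0 < t \<Longrightarrow> t < T \<Longrightarrow> \<epsilon> * h t > 0" by blast
  define y where "y t = (vector [f (t - s), g (t - s), h (t - s)] :: real^3)" for t
  define y' where "y' t = (vector [g (t - s), h (t - s),
      - \<epsilon> * \<gamma> - c * f (t - s) - b * g (t - s) - a * h (t - s)] :: real^3)" for t
  have "filippov_solution (relay_system a b c \<gamma>) {s..s + T} y"
  proof (rule filippov_solution_of_derivative)
    have shift: "((\<lambda>t. F (t - s)) has_real_derivative D) (at t)"
      if "(F has_real_derivative D) (at (t - s))" for F D t
      using DERIV_shift[of F D t "- s"] that by simp
    show "(y has_vector_derivative y' t) (at t)" for t
      unfolding y_def y'_def by (intro has_vector_derivative_vector3 shift f g h)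
    have "continuous_on UNIV f" "continuous_on UNIV g" "continuous_on UNIV h"
      using cont by (simp_all add: continuous_on_eq_continuous_at)
    then have "continuous_on {s..s + T} (\<lambda>t. f (t - s))" "continuous_on {s..s + T} (\<lambda>t. g (t - s))"
      "continuous_on {s..s + T} (\<lambda>t. h (t - s))"
      by (auto elim!: continuous_on_compose2 intro!: continuous_intros)
    then show "continuous_on {s..s + T} y'"
      unfolding y'_def
      by (intro continuous_on_vector3 continuous_on_diff continuous_on_mult continuous_on_const)
    fix t assume t: "t \<in> {s<..<s + T}"
    then have "\<epsilon> * h (t - s) > 0" using T(2)[of "t - s"] by simp
    then have "\<epsilon> \<in> sign_set (h (t - s))" using \<epsilon> by (auto simp: sign_set_def)
    then show "y' t \<in> relay_system a b c \<gamma> (y t)"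
      unfolding mem_relay_system by (intro bexI[of _ \<epsilon>]) (auto simp: y_def y'_def vec_eq_iff forall_3)
  qed
  moreover have "y s = q" by (simp add: y_def init vec_eq_iff forall_3)
  ultimately show ?thesis using T(1) by blast
qed

text \<open>With x3 = 0 the velocity x2 is constant and x1 is affine in time, so c x1 + b x2 is the
  affine expression in \<open>le\<close>. Sliding is admissible as long as some relay value can
  cancel it.\<close>

lemma relay_local_solution_sliding:
  fixes q :: "real^3"
  assumes \<gamma>: "\<gamma> > 0" and q3: "q $ 3 = 0" and T: "T > 0"
    and le: "\<And>t. 0 \<le> t \<Longrightarrow> t \<le> T \<Longrightarrow> \<bar>c * q $ 1 + b * q $ 2 + c * q $ 2 * t\<bar> \<le> \<gamma>"
  shows "\<exists>y. filippov_solution (relay_system a b c \<gamma>) {s..s + T} y \<and> y s = q"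
proof -
  define y where "y t = (vector [q $ 1 + q $ 2 * (t - s), q $ 2, 0] :: real^3)" for t
  have "filippov_solution (relay_system a b c \<gamma>) {s..s + T} y"
  proof (rule filippov_solution_of_derivative)
    show "(y has_vector_derivative vector [q $ 2, 0, 0]) (at t)" for t
      unfolding y_def by (intro has_vector_derivative_vector3) (auto intro!: derivative_eq_intros)
    fix t assume t: "t \<in> {s<..<s + T}"
    \<comment> \<open>The equivalent control: the relay value that makes the third component of the
      field vanish.\<close>
    define r where "r = - (c * q $ 1 + b * q $ 2 + c * q $ 2 * (t - s)) / \<gamma>"
    have "\<bar>r\<bar> \<le> 1" using le[of "t - s"] t \<gamma> by (simp add: r_def abs_minus_commute)
    then have "r \<in> sign_set 0" by (auto simp: sign_set_def abs_le_iff)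
    moreover have "r * \<gamma> = - (c * q $ 1 + b * q $ 2 + c * q $ 2 * (t - s))"
      using \<gamma> by (simp add: r_def)
    ultimately show "vector [q $ 2, 0, 0] \<in> relay_system a b c \<gamma> (y t)"
      unfolding mem_relay_system
      by (intro bexI[of _ r]) (auto simp: y_def vec_eq_iff forall_3 algebra_simps)
  qed simp
  moreover have "y s = q" using q3 by (simp add: y_def vec_eq_iff forall_3)
  ultimately show ?thesis by blast
qed

lemma relay_local_solution:
  fixes q :: "real^3"
  assumes c: "c > 0" and \<gamma>: "\<gamma> > 0"
  shows "\<exists>T>0. \<exists>y. filippov_solution (relay_system a b c \<gamma>) {s..s + T} y \<and> y s = q"
proof -
  define \<sigma> where "\<sigma> = c * q $ 1 + b * q $ 2"
  have slide: ?thesis if "q $ 3 = 0" "\<bar>\<sigma>\<bar> < \<gamma> \<or> \<sigma> = - \<gamma> \<and> q $ 2 \<ge> 0 \<or> \<sigma> = \<gamma> \<and> q $ 2 \<le> 0"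
  proof -
    \<comment> \<open>The room for \<sigma> to drift: the distance to the nearer edge of the band
      when inside it, the full width \<open>2 * \<gamma>\<close> when starting on an edge and
      drifting inward or not at all.\<close>
    define m where "m = (if \<bar>\<sigma>\<bar> < \<gamma> then \<gamma> - \<bar>\<sigma>\<bar> else 2 * \<gamma>)"
    have m: "m > 0" using \<gamma> by (simp add: m_def)
    \<comment> \<open>The drift rate may be zero, hence the added 1.\<close>
    define T where "T = m / (\<bar>c * q $ 2\<bar> + 1)"
    have T: "T > 0" "\<bar>c * q $ 2\<bar> * T \<le> m"
      using m by (simp_all add: T_def field_simps)
    have "\<bar>\<sigma> + c * q $ 2 * t\<bar> \<le> \<gamma>" if t: "0 \<le> t" "t \<le> T" for t
    proof -
      have "\<bar>c * q $ 2 * t\<bar> \<le> \<bar>c * q $ 2\<bar> * T" using t by (simp add: abs_mult mult_left_mono)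
      then have *: "\<bar>c * q $ 2 * t\<bar> \<le> m" using T by linarith
      show ?thesis
      proof (cases "\<bar>\<sigma>\<bar> < \<gamma>")
        case True
        then show ?thesis using * by (simp add: m_def)
      next
        case False
        have "0 \<le> q $ 2 \<Longrightarrow> 0 \<le> c * q $ 2 * t" "q $ 2 \<le> 0 \<Longrightarrow> c * q $ 2 * t \<le> 0"
          using c t by (auto simp: mult_nonneg_nonneg mult_nonpos_nonneg mult_nonneg_nonpos)
        then show ?thesis using * False that(1) \<open>_ \<or> _\<close> by (auto simp: m_def)
      qed
    qed
    then show ?thesis
      using relay_local_solution_sliding[OF \<gamma> \<open>q $ 3 = 0\<close> T(1)] T(1) unfolding \<sigma>_def by blast
  qed

  consider "q $ 3 > 0" | "q $ 3 < 0" | "q $ 3 = 0" by linarith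
  then show ?thesis
  proof cases
    case 1
    then show ?thesis by (intro relay_local_solution_moving[OF c \<gamma>, of 1]) auto
  next
    case 2
    then show ?thesis by (intro relay_local_solution_moving[OF c \<gamma>, of "-1"]) auto
  next
    case 3
    \<comment> \<open>Sliding moves \<sigma> at rate \<open>c * q $ 2\<close>. Outside the band, or
      on an edge with outward drift, no relay value can hold the surface: the third coordinate
      becomes positive on the lower side and negative on the upper side. Otherwise sliding
      continues.\<close>
    consider "\<sigma> < - \<gamma> \<or> \<sigma> = - \<gamma> \<and> q $ 2 < 0" | "\<sigma> > \<gamma> \<or> \<sigma> = \<gamma> \<and> q $ 2 > 0"
      | "\<bar>\<sigma>\<bar> < \<gamma> \<or> \<sigma> = - \<gamma> \<and> q $ 2 \<ge> 0 \<or> \<sigma> = \<gamma> \<and> q $ 2 \<le> 0" by linarith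
    then show ?thesis
    proof cases
      case 1
      with \<open>q $ 3 = 0\<close> show ?thesis
        unfolding \<sigma>_def by (intro relay_local_solution_moving[OF c \<gamma>, of 1]) auto
    next
      case 2
      with \<open>q $ 3 = 0\<close> show ?thesis
        unfolding \<sigma>_def by (intro relay_local_solution_moving[OF c \<gamma>, of "-1"]) auto
    next
      case 3
      then show ?thesis using slide \<open>q $ 3 = 0\<close> by blast
    qed
  qed
qed

section \<open>Sticking and the final theorem\<close>

lemma relay_sticking:
  assumes a: "a > 0" and \<gamma>: "\<gamma> > 0" and x: "filippov_solution (relay_system a b c \<gamma>) {u..v} x"
    and "u \<le> v" and init: "x u $ 3 = 0"
    and lt: "\<And>t. t \<in> {u..v} \<Longrightarrow> \<bar>b * x t $ 2 + c * x t $ 1\<bar> < \<gamma>"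
  shows "x v $ 3 = 0"
proof -
  have "absolutely_continuous_on {u..v} (\<lambda>t. x t \<bullet> axis 3 1)"
    using x lipschitz_on_imp_absolutely_continuous_on[OF lipschitz_on_constant]
    by (intro absolutely_continuous_on_inner)
      (auto simp: filippov_solution_def locally_absolutely_continuous_on_def)
  then have "absolutely_continuous_on {u..v} (\<lambda>t. x t $ 3)" by (simp add: inner_axis)
  then have ac: "absolutely_continuous_on {u..v} (\<lambda>t. x t $ 3 * x t $ 3)"
    by (intro absolutely_continuous_on_mult)
  have "x v $ 3 * x v $ 3 \<le> x u $ 3 * x u $ 3"
  proof (rule absolutely_continuous_on_nonincreasing[OF \<open>u \<le> v\<close> ac])
    have "AE t in lborel. t \<in> {u<..<v} \<longrightarrow>
        (\<exists>w\<in>relay_system a b c \<gamma> (x t). (x has_vector_derivative w) (at t))"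
      using x by (simp add: filippov_solution_iff_interior)
    then show "AE t in lborel. t \<in> {u<..<v} \<longrightarrow>
        (\<exists>D\<le>0. ((\<lambda>t. x t $ 3 * x t $ 3) has_real_derivative D) (at t))"
    proof (elim eventually_mono, intro impI)
      fix t assume t: "t \<in> {u<..<v}" and "t \<in> {u<..<v} \<longrightarrow>
        (\<exists>w\<in>relay_system a b c \<gamma> (x t). (x has_vector_derivative w) (at t))"
      then obtain w where w: "w \<in> relay_system a b c \<gamma> (x t)" "(x has_vector_derivative w) (at t)"
        by blast
      then obtain r where r: "r \<in> sign_set (x t $ 3)"
        "w $ 3 = - c * x t $ 1 - b * x t $ 2 - a * x t $ 3 - r * \<gamma>"
        by (auto simp: mem_relay_system)
      have "((\<lambda>t. x t $ 3) has_real_derivative w $ 3) (at t)"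
        using bounded_linear.has_vector_derivative[OF bounded_linear_vec_nth w(2)]
        by (simp add: has_real_derivative_iff_has_vector_derivative)
      from DERIV_mult[OF this this]
      have "((\<lambda>t. x t $ 3 * x t $ 3) has_real_derivative 2 * (x t $ 3 * w $ 3)) (at t)"
        by (simp add: mult_ac)
      moreover have "x t $ 3 * w $ 3 \<le> 0"
      proof -
        have *: "\<bar>b * x t $ 2 + c * x t $ 1\<bar> < \<gamma>" using lt t by simp
        \<comment> \<open>On the surface the product vanishes for every relay value. Off it the
          relay is single-valued, \<open>\<gamma>\<close> outweighs the terms in the first two
          coordinates, and the damping \<open>a\<close> acts in the same direction.\<close>
        consider "x t $ 3 = 0" | "x t $ 3 > 0" "r = 1" | "x t $ 3 < 0" "r = -1"
          using r(1) by (auto simp: sign_set_def split: if_splits)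
        then show ?thesis
        proof cases
          case 2
          then have "a * x t $ 3 > 0" using a by simp
          then have "w $ 3 \<le> 0" using * 2 unfolding r(2) by simp
          then show ?thesis using 2 by (simp add: mult_nonneg_nonpos)
        next
          case 3
          then have "a * x t $ 3 < 0" using a by (simp add: mult_pos_neg)
          then have "w $ 3 \<ge> 0" using * 3 unfolding r(2) by simp
          then show ?thesis using 3 by (simp add: mult_nonpos_nonneg)
        qed simp
      qed
      ultimately show "\<exists>D\<le>0. ((\<lambda>t. x t $ 3 * x t $ 3) has_real_derivative D) (at t)"
        by (intro exI[of _ "2 * (x t $ 3 * w $ 3)"] conjI) linarith+
    qed
  qed
  then show ?thesis using init by (auto simp: mult_le_0_iff)
qed

theorem theorem2:
  fixes a b c \<gamma> t0 :: real and x0 :: "real^3"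
  assumes "a > 0" and "b > 0" and "c > 0" and "\<gamma> > 0"
    and "globally_asymptotically_stable (relay_system a b c \<gamma>)"
    and "t0 \<ge> 0"
    and "x0 $ 3 = 0"
    and "\<bar>b * x0 $ 2 + c * x0 $ 1\<bar> < \<gamma>"
  shows "(\<exists>x. filippov_solution (relay_system a b c \<gamma>) {t0..} x \<and> x t0 = x0) \<and>
    (\<forall>x t1. filippov_solution (relay_system a b c \<gamma>) {t0..} x \<and> x t0 = x0 \<and> t0 < t1 \<and>
        (\<forall>t\<in>{t0..<t1}. \<bar>b * x t $ 2 + c * x t $ 1\<bar> < \<gamma>) \<longrightarrow>
      sticking_on {t0..<t1} x \<and>
      (\<forall>z. filippov_solution (relay_system a b c \<gamma>) {t0..<t1} z \<and> z t0 = x0 \<longrightarrow>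
        (\<forall>t\<in>{t0..<t1}. z t = x t)))"
proof (intro conjI allI impI)
  interpret dissipative_inclusion "relay_system a b c \<gamma>" "onorm ((*v) (relay_A a b c))"
    using assms(4) by (rule dissipative_relay_system)
  show "\<exists>x. filippov_solution (relay_system a b c \<gamma>) {t0..} x \<and> x t0 = x0"
    using relay_local_solution[OF assms(3,4)] by (intro filippov_solution_exists)
  fix x t1
  assume x: "filippov_solution (relay_system a b c \<gamma>) {t0..} x \<and> x t0 = x0 \<and> t0 < t1 \<and>
      (\<forall>t\<in>{t0..<t1}. \<bar>b * x t $ 2 + c * x t $ 1\<bar> < \<gamma>)"
  show "sticking_on {t0..<t1} x"
    unfolding sticking_on_def
  proof
    fix t assume t: "t \<in> {t0..<t1}"
    show "x t $ 3 = 0"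
    proof (rule relay_sticking[OF assms(1,4)])
      show "filippov_solution (relay_system a b c \<gamma>) {t0..t} x"
        using x by (auto intro: filippov_solution_subset)
    qed (use x t assms(7) in auto)
  qed
  fix z
  assume z: "filippov_solution (relay_system a b c \<gamma>) {t0..<t1} z \<and> z t0 = x0"
  show "\<forall>t\<in>{t0..<t1}. z t = x t"
  proof
    fix t assume t: "t \<in> {t0..<t1}"
    \<comment> \<open>The competitor \<open>z\<close> is given only up to \<open>t1\<close> and is
      not assumed to satisfy the inequality, so \<open>x\<close> is restricted to the same interval
      and forward uniqueness compares the two directly.\<close>
    have "filippov_solution (relay_system a b c \<gamma>) {t0..<t1} x"
      by (rule filippov_solution_subset[OF conjunct1[OF x]]) (simp add: subset_iff)
    then show "z t = x t"
      using x z t filippov_solution_unique[of "{t0..<t1}" z x t0 t] by simp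
  qed
qed

end
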